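(* Work in the setting of the context (in particular $R(\cdot)+\bar R(\cdot+\delta)\equiv0$). Let $M>0$ be a symmetric $n\times n$ matrix, suppose that conditions (A4) and (A5) of the context hold and that $B(\cdot)=I$. Then the delayed Riccati equation $$\left\{\begin{aligned}\dot P(t)=&\,PA+A^\top P-2[Q(t)+\bar Q(t+\delta)]+PBP^{-1}B^\top P+PC\mathcal N^{-1}C^\top P\\&+P\bar B(t)P^{-1}(t-\delta)\bar B(t)^\top P+P\bar C(t)\mathcal N^{-1}(t-\delta)\bar C(t)^\top P,\quad t\in[s,T],\\P(T)=&\ M^{-1},\qquad P(t)=I,\ t\in[s-\delta,s),\end{aligned}\right.$$ is uniquely solvable, with solution $P(\cdot)\in C([s,T];\bar{\mathbf S}^n_+)$.
   Context: $T>0$, $s\in[0,T]$, and $\delta>0$ is a sufficiently small delay (there is $\delta_0>0$ depending only on $T$ and on bounds of the data such that $0<\delta\le\delta_0$ is assumed). $\mathbf S^n$: symmetric $n\times n$ real matrices; $\mathbf S^n_+$: positive semidefinite ones; $\bar{\mathbf S}^n_+$: positive definite ones. All coefficients are deterministic bounded measurable functions, defined at all times at which they are evaluated: $A,B,\bar B$ are $\mathbf R^{n\times n}$-valued, $C,\bar C$ are $\mathbf R^{n\times d}$-valued, $Q,\bar Q,R,\bar R$ are $\mathbf S^n$-valued, $N,\bar N$ are $\mathbf S^d$-valued; for some $\alpha>0$, $Q(t)+\bar Q(t+\delta)\ge0$ and $N(t)+\bar N(t+\delta)\ge\alpha I$ for a.e. $t\in[s-\delta,T]$; and $R(t)+\bar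 R(t+\delta)\equiv0$. $\mathcal N(t):=2N(t)+2\bar N(t+\delta)$. Arguments omitted are $t$. The prescribed values on $[s-\delta,s)$ are not required to match the value at $s$. For a bounded function $\hat A:[s,T]\to\mathbf R^{n\times n}$, the time-advanced ODE associated with $\hat A$ and $\bar B$ is $$\dot\Upsilon(t)=\hat A(t)^\top\Upsilon(t)+\bar B(t+\delta)^\top\Upsilon(t+\delta),\ t\in[s,T],\qquad\Upsilon(s)=I,\quad\Upsilon(t)=0,\ t\in(T,T+\delta].$$ Iterative scheme: $\Sigma^0(t)=M$ for $t\in[s,T]$, $\Sigma^0(t)=I$ for $t\in[s-\delta,s)$; for $i=0,1,2,\dots$, $$\hat A_i(t)=A(t)-2\Sigma^i(t)[Q(t)+\bar Q(t+\delta)],$$ $$\hat H_i(t)=C(t)\mathcal N^{-1}(t)C(t)^\top+\bar C(t)\mathcal N^{-1}(t-\delta)\bar C(t)^\top+2\Sigma^i(t)[Q(t)+\bar Q(t+\delta)]\Sigma^i(t),$$ and $\Sigma^{i+1}$ is the solution of $$\dot\Sigma^{i+1}=-\Sigma^{i+1}\hat A_i^\top-\hat A_i\Sigma^{i+1}-B\Sigma^{i+1}B^\top-\bar B(t)\Sigma^{i+1}(t-\delta)\bar B(t)^\top-\hat H_i,\ t\in[s,T],\quad\Sigma^{i+1}(T)=M,\ \Sigma^{i+1}(t)=I\text{ on }[s-\delta,s).$$ (A4): for every $i=0,1,2,\dots$, the solution $\Upsilon_i(\cdot)$ of the time-advanced ODE associated with $\hat A_i$ and $\bar B$ satisfies $\Upsilon_i(\cdot)>0$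 on $[s,T]$ (positive definite). (A5): the solution $\Upsilon(\cdot)$ of the time-advanced ODE associated with $\hat A(t):=A(t)-2\Sigma(t)[Q(t)+\bar Q(t+\delta)]$ and $\bar B$ satisfies $\Upsilon(\cdot)>0$ on $[s,T]$, where $\Sigma$ is the solution in $C([s,T];\mathbf S^n_+)$ of $$\dot\Sigma=-\Sigma A^\top-A\Sigma+2\Sigma[Q+\bar Q(t+\delta)]\Sigma-B\Sigma B^\top-C\mathcal N^{-1}C^\top-\bar B(t)\Sigma(t-\delta)\bar B(t)^\top-\bar C(t)\mathcal N^{-1}(t-\delta)\bar C(t)^\top,\ t\in[s,T],$$ $\Sigma(T)=M$, $\Sigma(t)=I$ for $t\in[s-\delta,s)$. *)

theory Defs
  imports "HOL-Analysis.Analysis"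
begin

definition sym_mats :: "(real^'n^'n) set" where
  "sym_mats = {X. transpose X = X}"

(* Positivity of the quadratic form only.  The solutions of the time-advanced ODE need not be
   symmetric, so symmetry is not part of this predicate. *)
definition pos_form :: "real^'n^'n \<Rightarrow> bool" where
  "pos_form X \<longleftrightarrow> (\<forall>x. x \<noteq> 0 \<longrightarrow> 0 < x \<bullet> (X *v x))"

definition psd_mats :: "(real^'n^'n) set" where
  "psd_mats = {X \<in> sym_mats. \<forall>x. 0 \<le> x \<bullet> (X *v x)}"

definition pd_mats :: "(real^'n^'n) set" where
  "pd_mats = {X \<in> sym_mats. pos_form X}"

(* X is a Caratheodory solution on [a,b] of X'(t) = F t.  The coefficients are only bounded and
   measurable, so the equation is understood in integrated form; the right-hand side F is
   written out in terms of X itself (and its delayed or advanced values) at each use. *)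
definition ode_solution_on ::
    "real \<Rightarrow> real \<Rightarrow> (real \<Rightarrow> real^'n^'n) \<Rightarrow> (real \<Rightarrow> real^'n^'n) \<Rightarrow> bool" where
  "ode_solution_on a b X F \<longleftrightarrow>
     continuous_on {a..b} X \<and> (\<forall>t\<in>{a..b}. (F has_integral (X t - X a)) {a..t})"

definition bdd_meas_on :: "real set \<Rightarrow> real \<Rightarrow> (real \<Rightarrow> 'a::euclidean_space) \<Rightarrow> bool" where
  "bdd_meas_on S K f \<longleftrightarrow> f \<in> borel_measurable (lebesgue_on S) \<and> (\<forall>t\<in>S. norm (f t) \<le> K)"

(* real^'d^'n is the type of matrices with rows indexed by 'n and columns indexed by 'd. *)
record ('n::finite, 'd::finite) lq_data =
  cA    :: "real \<Rightarrow> real^'n^'n"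
  cB    :: "real \<Rightarrow> real^'n^'n"
  cBbar :: "real \<Rightarrow> real^'n^'n"
  cC    :: "real \<Rightarrow> real^'d^'n"
  cCbar :: "real \<Rightarrow> real^'d^'n"
  cQ    :: "real \<Rightarrow> real^'n^'n"
  cQbar :: "real \<Rightarrow> real^'n^'n"
  cR    :: "real \<Rightarrow> real^'n^'n"
  cRbar :: "real \<Rightarrow> real^'n^'n"
  cN    :: "real \<Rightarrow> real^'d^'d"
  cNbar :: "real \<Rightarrow> real^'d^'d"

definition Qsum :: "('n::finite, 'd::finite) lq_data \<Rightarrow> real \<Rightarrow> real \<Rightarrow> real^'n^'n" where
  "Qsum D \<delta> t = cQ D t + cQbar D (t + \<delta>)"

definition calN :: "('n::finite, 'd::finite) lq_data \<Rightarrow> real \<Rightarrow> real \<Rightarrow> real^'d^'d" where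
  "calN D \<delta> t = 2 *\<^sub>R cN D t + 2 *\<^sub>R cNbar D (t + \<delta>)"

(* Each coefficient is constrained exactly at the times at which it gets evaluated; the barred
   weights and the delayed drift are evaluated at the advanced time t + \<delta>. *)
definition lq_setting ::
    "real \<Rightarrow> real \<Rightarrow> real \<Rightarrow> real \<Rightarrow> real \<Rightarrow> ('n::finite, 'd::finite) lq_data \<Rightarrow> bool" where
  "lq_setting T K \<alpha> \<delta> s D \<longleftrightarrow>
     bdd_meas_on {s..T} K (cA D) \<and> bdd_meas_on {s..T} K (cB D) \<and>
     bdd_meas_on {s..T + \<delta>} K (cBbar D) \<and>
     bdd_meas_on {s..T} K (cC D) \<and> bdd_meas_on {s..T} K (cCbar D) \<and>
     bdd_meas_on {s - \<delta>..T} K (cQ D) \<and> bdd_meas_on {s..T + \<delta>} K (cQbar D) \<and>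
     bdd_meas_on {s - \<delta>..T} K (cR D) \<and> bdd_meas_on {s..T + \<delta>} K (cRbar D) \<and>
     bdd_meas_on {s - \<delta>..T} K (cN D) \<and> bdd_meas_on {s..T + \<delta>} K (cNbar D) \<and>
     (\<forall>t\<in>{s - \<delta>..T}. cQ D t \<in> sym_mats \<and> cR D t \<in> sym_mats \<and> cN D t \<in> sym_mats) \<and>
     (\<forall>t\<in>{s..T + \<delta>}. cQbar D t \<in> sym_mats \<and> cRbar D t \<in> sym_mats \<and> cNbar D t \<in> sym_mats) \<and>
     (AE t in lebesgue_on {s - \<delta>..T}. Qsum D \<delta> t \<in> psd_mats) \<and>
     (AE t in lebesgue_on {s - \<delta>..T}. cN D t + cNbar D (t + \<delta>) - \<alpha> *\<^sub>R mat 1 \<in> psd_mats) \<and>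
     (\<forall>t\<in>{s - \<delta>..T}. cR D t + cRbar D (t + \<delta>) = 0)"

definition advanced_ode_solution ::
    "real \<Rightarrow> real \<Rightarrow> real \<Rightarrow> (real \<Rightarrow> real^'n^'n) \<Rightarrow> (real \<Rightarrow> real^'n^'n) \<Rightarrow> (real \<Rightarrow> real^'n^'n) \<Rightarrow> bool"
  where
  "advanced_ode_solution T \<delta> s Ahat Bbar Y \<longleftrightarrow>
     ode_solution_on s T Y
       (\<lambda>t. transpose (Ahat t) ** Y t + transpose (Bbar (t + \<delta>)) ** Y (t + \<delta>)) \<and>
     Y s = mat 1 \<and> (\<forall>t\<in>{T<..T + \<delta>}. Y t = 0)"

definition hatA ::
    "('n::finite, 'd::finite) lq_data \<Rightarrow> real \<Rightarrow> (real \<Rightarrow> real^'n^'n) \<Rightarrow> real \<Rightarrow> real^'n^'n" where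
  "hatA D \<delta> S t = cA D t - 2 *\<^sub>R (S t ** Qsum D \<delta> t)"

definition hatH ::
    "('n::finite, 'd::finite) lq_data \<Rightarrow> real \<Rightarrow> (real \<Rightarrow> real^'n^'n) \<Rightarrow> real \<Rightarrow> real^'n^'n" where
  "hatH D \<delta> S t =
     cC D t ** matrix_inv (calN D \<delta> t) ** transpose (cC D t)
     + cCbar D t ** matrix_inv (calN D \<delta> (t - \<delta>)) ** transpose (cCbar D t)
     + 2 *\<^sub>R (S t ** Qsum D \<delta> t ** S t)"

definition iterative_scheme ::
    "real \<Rightarrow> real \<Rightarrow> real \<Rightarrow> ('n::finite, 'd::finite) lq_data \<Rightarrow> real^'n^'n
      \<Rightarrow> (nat \<Rightarrow> real \<Rightarrow> real^'n^'n) \<Rightarrow> bool" where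
  "iterative_scheme T \<delta> s D M S \<longleftrightarrow>
     (\<forall>t\<in>{s..T}. S 0 t = M) \<and>
     (\<forall>i. \<forall>t\<in>{s - \<delta>..<s}. S i t = mat 1) \<and>
     (\<forall>i. S (Suc i) T = M \<and>
        ode_solution_on s T (S (Suc i))
          (\<lambda>t. - (S (Suc i) t ** transpose (hatA D \<delta> (S i) t))
               - hatA D \<delta> (S i) t ** S (Suc i) t
               - cB D t ** S (Suc i) t ** transpose (cB D t)
               - cBbar D t ** S (Suc i) (t - \<delta>) ** transpose (cBbar D t)
               - hatH D \<delta> (S i) t))"

definition cond_A4 ::
    "real \<Rightarrow> real \<Rightarrow> real \<Rightarrow> ('n::finite, 'd::finite) lq_data \<Rightarrow> real^'n^'n \<Rightarrow> bool" where
  "cond_A4 T \<delta> s D M \<longleftrightarrow>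
     (\<forall>S Y i. iterative_scheme T \<delta> s D M S \<longrightarrow>
        advanced_ode_solution T \<delta> s (hatA D \<delta> (S i)) (cBbar D) Y \<longrightarrow>
        (\<forall>t\<in>{s..T}. pos_form (Y t)))"

definition Sigma_solution ::
    "real \<Rightarrow> real \<Rightarrow> real \<Rightarrow> ('n::finite, 'd::finite) lq_data \<Rightarrow> real^'n^'n
      \<Rightarrow> (real \<Rightarrow> real^'n^'n) \<Rightarrow> bool" where
  "Sigma_solution T \<delta> s D M S \<longleftrightarrow>
     (\<forall>t\<in>{s..T}. S t \<in> psd_mats) \<and>
     ode_solution_on s T S
       (\<lambda>t. - (S t ** transpose (cA D t)) - cA D t ** S t
            + 2 *\<^sub>R (S t ** Qsum D \<delta> t ** S t)
            - cB D t ** S t ** transpose (cB D t)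
            - cC D t ** matrix_inv (calN D \<delta> t) ** transpose (cC D t)
            - cBbar D t ** S (t - \<delta>) ** transpose (cBbar D t)
            - cCbar D t ** matrix_inv (calN D \<delta> (t - \<delta>)) ** transpose (cCbar D t)) \<and>
     S T = M \<and> (\<forall>t\<in>{s - \<delta>..<s}. S t = mat 1)"

definition cond_A5 ::
    "real \<Rightarrow> real \<Rightarrow> real \<Rightarrow> ('n::finite, 'd::finite) lq_data \<Rightarrow> real^'n^'n \<Rightarrow> bool" where
  "cond_A5 T \<delta> s D M \<longleftrightarrow>
     (\<forall>S Y. Sigma_solution T \<delta> s D M S \<longrightarrow>
        advanced_ode_solution T \<delta> s (hatA D \<delta> S) (cBbar D) Y \<longrightarrow>
        (\<forall>t\<in>{s..T}. pos_form (Y t)))"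

(* Solutions are continuous, symmetric and invertible on [s,T]; invertibility is what gives the
   terms with the inverse of P a meaning (matrix_inv is unspecified on singular matrices). *)
definition riccati_solution ::
    "real \<Rightarrow> real \<Rightarrow> real \<Rightarrow> ('n::finite, 'd::finite) lq_data \<Rightarrow> real^'n^'n
      \<Rightarrow> (real \<Rightarrow> real^'n^'n) \<Rightarrow> bool" where
  "riccati_solution T \<delta> s D M P \<longleftrightarrow>
     (\<forall>t\<in>{s..T}. P t \<in> sym_mats \<and> invertible (P t)) \<and>
     ode_solution_on s T P
       (\<lambda>t. P t ** cA D t + transpose (cA D t) ** P t - 2 *\<^sub>R Qsum D \<delta> t
            + P t ** cB D t ** matrix_inv (P t) ** transpose (cB D t) ** P t
            + P t ** cC D t ** matrix_inv (calN D \<delta> t) ** transpose (cC D t) ** P t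
            + P t ** cBbar D t ** matrix_inv (P (t - \<delta>)) ** transpose (cBbar D t) ** P t
            + P t ** cCbar D t ** matrix_inv (calN D \<delta> (t - \<delta>)) ** transpose (cCbar D t) ** P t) \<and>
     P T = matrix_inv M \<and> (\<forall>t\<in>{s - \<delta>..<s}. P t = mat 1)"

end

theory Submission
  imports Defs
begin

text \<open>Put \<open>\<Sigma> = P\<^sup>-\<^sup>1\<close>: positive definite solutions of the Riccati equation correspond to positive
  definite solutions of the equation for \<open>\<Sigma>\<close>, which is polynomial with a quadratic term of
  favourable sign. Read backwards from \<open>T\<close> the delay becomes an advance, which for small \<open>\<delta>\<close>
  is harmless in the sup norm weighted by \<open>exp (\<theta> * (t - T))\<close>: there the integral operator of a
  truncated, globally Lipschitz equation is a contraction. Its solution stays positive definite,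
  and a trace estimate, independent of the truncation, shows that the truncation is never active.
  The same estimate puts every other positive solution into the contraction regime; an invertible
  symmetric solution of the Riccati equation cannot leave the positive cone, so uniqueness carries
  over to it.\<close>

section \<open>Matrices and the positive semidefinite cone\<close>

text \<open>Read backwards, the term at t - \<delta> refers to values not yet reached, so positivity
  cannot be propagated step by step: at the moment where the cone might be left, nothing is known
  about the delayed value. \<open>trunc_rhs\<close> therefore projects the delayed argument onto the
  cone, which gives that term a sign unconditionally; the projection disappears once the whole
  solution is known to be positive. Cutting the quadratic term at radius R makes the Lipschitz
  constant, hence the weight needed for contraction and the admissible delay, depend on R. There is
  no circle: the trace estimate discards the quadratic term by its sign, so its weight \<theta>1
  depends only on the coefficient bound L and the dimension. Thus \<theta>1 fixes R, and R fixes the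
  larger weight \<theta> and the threshold ln 2 / \<theta>. The sign conditions on the weights hold
  only almost everywhere. The abstract equation is therefore posed for modified coefficients that
  satisfy them at every time and agree with the given ones off a null set.\<close>

lemma norm_matrix_sq: "(norm (X :: real^'m^'n))\<^sup>2 = (\<Sum>i\<in>UNIV. \<Sum>j\<in>UNIV. (X$i$j)\<^sup>2)"
  by (simp add: norm_vec_def L2_set_def sum_nonneg)

lemma norm_matrix_transpose [simp]: "norm (transpose (X :: real^'m^'n)) = norm X"
proof -
  have "(norm (transpose X))\<^sup>2 = (norm X)\<^sup>2"
    unfolding norm_matrix_sq transpose_def by (simp, rule sum.swap)
  then show ?thesis by simp
qed

lemma norm_matrix_vector_mult_le: "norm ((A :: real^'m^'n) *v x) \<le> norm A * norm x"
proof -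
  have "(norm (A *v x))\<^sup>2 = (\<Sum>i\<in>UNIV. (A$i \<bullet> x)\<^sup>2)"
    by (simp add: norm_vec_def L2_set_def sum_nonneg matrix_vector_mul_component)
  also have "\<dots> \<le> (\<Sum>i\<in>UNIV. (norm (A$i))\<^sup>2 * (norm x)\<^sup>2)"
    by (intro sum_mono) (simp add: Cauchy_Schwarz_ineq power2_norm_eq_inner)
  also have "\<dots> = (norm A * norm x)\<^sup>2"
    by (simp add: norm_vec_def L2_set_def sum_nonneg power_mult_distrib sum_distrib_right)
  finally show ?thesis by (rule power2_le_imp_le) simp
qed

lemma norm_matrix_mult_le: "norm ((A :: real^'m^'n) ** (B :: real^'k^'m)) \<le> norm A * norm B"
proof -
  have "(norm (A ** B))\<^sup>2 = (norm (transpose B ** transpose A))\<^sup>2"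
    by (simp flip: matrix_transpose_mul)
  also have "\<dots> = (\<Sum>i\<in>UNIV. (norm (transpose B *v (A$i)))\<^sup>2)"
    unfolding matrix_transpose_mul[symmetric] norm_matrix_transpose
    by (simp add: norm_matrix_sq) (simp add: norm_vec_def L2_set_def sum_nonneg matrix_matrix_mult_def
        vector_matrix_mult_def)
  also have "\<dots> \<le> (\<Sum>i\<in>UNIV. (norm B * norm (A$i))\<^sup>2)"
    by (intro sum_mono power_mono) (use norm_matrix_vector_mult_le[of "transpose B"] in auto)
  also have "\<dots> = (norm A * norm B)\<^sup>2"
    by (simp add: norm_vec_def[of A] L2_set_def sum_nonneg power_mult_distrib sum_distrib_left mult.commute)
  finally show ?thesis by (rule power2_le_imp_le) simp
qed

lemma norm_matrix_mult3_le:
  fixes P :: "real^'m^'n" and Q :: "real^'k^'m" and R :: "real^'l^'k"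
  assumes "norm P \<le> p" "norm Q \<le> q" "norm R \<le> r"
  shows "norm (P ** Q ** R) \<le> p * q * r"
proof -
  have "norm (P ** Q ** R) \<le> norm (P ** Q) * norm R" by (rule norm_matrix_mult_le)
  also have "\<dots> \<le> (norm P * norm Q) * norm R"
    by (intro mult_right_mono norm_matrix_mult_le) simp
  also have "\<dots> \<le> p * q * r"
    using assms order_trans[OF norm_ge_zero assms(1)] order_trans[OF norm_ge_zero assms(2)]
    by (intro mult_mono) auto
  finally show ?thesis .
qed

lemma bounded_bilinear_matrix_mult:
  "bounded_bilinear ((**) :: real^'m^'n \<Rightarrow> real^'k^'m \<Rightarrow> real^'k^'n)"
  by (rule bounded_bilinear.intro)
    (auto simp: matrix_add_ldistrib matrix_matrix_mult_def vec_eq_iff algebra_simps sum.distrib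
      sum_distrib_left intro!: exI[of _ 1] norm_matrix_mult_le[unfolded matrix_matrix_mult_def, simplified mult.commute])

lemma bounded_bilinear_matrix_vector_mult:
  "bounded_bilinear ((*v) :: real^'m^'n \<Rightarrow> real^'m \<Rightarrow> real^'n)"
  by (rule bounded_bilinear.intro)
    (auto simp: matrix_vector_mult_def vec_eq_iff algebra_simps sum.distrib
      sum_distrib_left intro!: exI[of _ 1] norm_matrix_vector_mult_le[unfolded matrix_vector_mult_def, simplified mult.commute])

lemma bounded_linear_transpose: "bounded_linear (transpose :: real^'m^'n \<Rightarrow> real^'n^'m)"
  by (rule bounded_linear_intro[of _ 1]) (auto simp: transpose_def vec_eq_iff norm_matrix_transpose[unfolded transpose_def])

lemmas continuous_on_matrix_mult [continuous_intros] =
  bounded_bilinear.continuous_on[OF bounded_bilinear_matrix_mult]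
lemmas continuous_on_matrix_vector_mult [continuous_intros] =
  bounded_bilinear.continuous_on[OF bounded_bilinear_matrix_vector_mult]
lemmas continuous_on_transpose [continuous_intros] =
  bounded_linear.continuous_on[OF bounded_linear_transpose]

lemmas matrix_mult_simps =
  bounded_bilinear.add_left[OF bounded_bilinear_matrix_mult]
  bounded_bilinear.add_right[OF bounded_bilinear_matrix_mult]
  bounded_bilinear.diff_left[OF bounded_bilinear_matrix_mult]
  bounded_bilinear.diff_right[OF bounded_bilinear_matrix_mult]
  bounded_bilinear.minus_left[OF bounded_bilinear_matrix_mult]
  bounded_bilinear.minus_right[OF bounded_bilinear_matrix_mult]
  bounded_bilinear.scaleR_left[OF bounded_bilinear_matrix_mult]
  bounded_bilinear.scaleR_right[OF bounded_bilinear_matrix_mult]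

lemmas matrix_vector_simps =
  bounded_bilinear.add_left[OF bounded_bilinear_matrix_vector_mult]
  bounded_bilinear.add_right[OF bounded_bilinear_matrix_vector_mult]
  bounded_bilinear.diff_left[OF bounded_bilinear_matrix_vector_mult]
  bounded_bilinear.diff_right[OF bounded_bilinear_matrix_vector_mult]
  bounded_bilinear.minus_left[OF bounded_bilinear_matrix_vector_mult]
  bounded_bilinear.minus_right[OF bounded_bilinear_matrix_vector_mult]
  bounded_bilinear.scaleR_left[OF bounded_bilinear_matrix_vector_mult]
  bounded_bilinear.scaleR_right[OF bounded_bilinear_matrix_vector_mult]
  bounded_bilinear.zero_left[OF bounded_bilinear_matrix_vector_mult]
  bounded_bilinear.zero_right[OF bounded_bilinear_matrix_vector_mult]

lemmas transpose_simps =
  linear_add[OF bounded_linear.linear[OF bounded_linear_transpose]]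
  linear_diff[OF bounded_linear.linear[OF bounded_linear_transpose]]
  linear_cmul[OF bounded_linear.linear[OF bounded_linear_transpose]]
  linear_neg[OF bounded_linear.linear[OF bounded_linear_transpose]]
  matrix_transpose_mul transpose_transpose

lemma inner_matrix_transpose: "x \<bullet> ((A :: real^'m^'n) *v y) = (transpose A *v x) \<bullet> y"
  by (simp add: dot_lmul_matrix transpose_matrix_vector)

lemma matrix_mult_axis: "(A :: real^'m^'n) *v axis j 1 = column j A"
  by (simp add: vec_eq_iff matrix_vector_mult_def column_def axis_def if_distrib cong: if_cong)

section \<open>Matrix inverses: algebra, Cramer's rule, continuity\<close>

lemma matrix_inv_right_inverse: "invertible (X :: real^'n^'n) \<Longrightarrow> X ** matrix_inv X = mat 1"
  and matrix_inv_left_inverse: "invertible (X :: real^'n^'n) \<Longrightarrow> matrix_inv X ** X = mat 1"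
  unfolding invertible_def matrix_inv_def by (metis (mono_tags, lifting) someI_ex)+

lemma matrix_inv_eqI:
  assumes "(X :: real^'n^'n) ** Y = mat 1" shows "matrix_inv X = Y"
proof -
  have "invertible X" using assms matrix_left_right_inverse unfolding invertible_def by blast
  then show ?thesis
    by (metis assms matrix_inv_left_inverse matrix_mul_assoc matrix_mul_lid matrix_mul_rid)
qed

lemma invertible_matrix_inv: "invertible (X :: real^'n^'n) \<Longrightarrow> invertible (matrix_inv X)"
  unfolding invertible_def using matrix_inv_left_inverse matrix_inv_right_inverse invertible_def by blast

lemma matrix_inv_matrix_inv: "invertible (X :: real^'n^'n) \<Longrightarrow> matrix_inv (matrix_inv X) = X"
  by (rule matrix_inv_eqI) (rule matrix_inv_left_inverse)

lemma transpose_matrix_inv: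
  assumes "invertible (X :: real^'n^'n)"
  shows "transpose (matrix_inv X) = matrix_inv (transpose X)"
  by (metis assms matrix_inv_eqI matrix_inv_left_inverse matrix_transpose_mul transpose_mat)

lemma matrix_inv_mat_1 [simp]: "matrix_inv (mat 1 :: real^'n^'n) = mat 1"
  by (rule matrix_inv_eqI) simp

text \<open>Cramer's rule, applied to the columns of the inverse. It writes each entry as a quotient
  of determinants, from which continuity of inversion is read off.\<close>

lemma matrix_inv_nth:
  fixes X :: "real^'n^'n"
  assumes "invertible X"
  shows "matrix_inv X $ i $ j
    = det (\<chi> a b. if b = i then axis j 1 $ a else X $ a $ b) / det X"
proof -
  have "X *v column j (matrix_inv X) = axis j 1"
    by (metis assms matrix_inv_right_inverse matrix_mult_axis matrix_vector_mul_assoc matrix_vector_mul_lid)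
  moreover have "det X \<noteq> 0" using assms invertible_det_nz by blast
  ultimately have "column j (matrix_inv X)
      = (\<chi> k. det (\<chi> a b. if b = k then axis j 1 $ a else X $ a $ b) / det X)"
    using cramer by blast
  then have "column j (matrix_inv X) $ i = \<dots> $ i" by simp
  then show ?thesis by (simp add: column_def)
qed

lemma continuous_on_det [continuous_intros]:
  fixes f :: "'a::topological_space \<Rightarrow> real^'n^'n"
  shows "continuous_on S f \<Longrightarrow> continuous_on S (\<lambda>x. det (f x))"
  unfolding det_def by (intro continuous_intros)

lemma continuous_on_matrix_inv [continuous_intros]:
  fixes f :: "'a::topological_space \<Rightarrow> real^'n^'n"
  assumes f: "continuous_on S f" and inv: "\<And>x. x \<in> S \<Longrightarrow> invertible (f x)"
  shows "continuous_on S (\<lambda>x. matrix_inv (f x))"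
proof -
  have "continuous_on S (\<lambda>x. (\<chi> i j. det (\<chi> a b. if b = i then axis j 1 $ a else f x $ a $ b)
          / det (f x)) :: real^'n^'n)"
  proof (intro continuous_on_vec_lambda continuous_on_divide continuous_on_det f ballI)
    show "continuous_on S (\<lambda>x. if b = i then axis j 1 $ a else f x $ a $ b)" for i j a b :: 'n
      by (cases "b = i") (auto intro!: continuous_intros f)
  qed (use inv invertible_det_nz in blast)
  then show ?thesis
    by (rule continuous_on_eq) (simp add: vec_eq_iff matrix_inv_nth inv)
qed

section \<open>Quadratic forms and the positive semidefinite cone\<close>

lemma sym_quadratic_expand:
  assumes "X \<in> sym_mats"
  shows "(x + c *\<^sub>R y) \<bullet> (X *v (x + c *\<^sub>R y))
    = x \<bullet> (X *v x) + 2 * c * (y \<bullet> (X *v x)) + c\<^sup>2 * (y \<bullet> (X *v y))"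
proof -
  have "x \<bullet> (X *v y) = y \<bullet> (X *v x)"
    using assms inner_matrix_transpose[of x X y] by (simp add: sym_mats_def inner_commute)
  then show ?thesis
    by (simp add: matrix_vector_simps inner_simps power2_eq_square algebra_simps)
qed

text \<open>Moving from x in direction -X x changes the form at first order by a negative multiple
  of the squared norm of X x. A nonnegative form that is nonpositive at x cannot allow this.\<close>

lemma psd_isotropic_imp_kernel:
  assumes X: "X \<in> psd_mats" and x: "x \<bullet> (X *v x) \<le> 0"
  shows "X *v x = 0"
proof (rule ccontr)
  assume "X *v x \<noteq> 0"
  define y where "y = X *v x"
  define b where "b = y \<bullet> (X *v y)"
  have y: "y \<bullet> y > 0" using \<open>X *v x \<noteq> 0\<close> by (simp add: y_def)
  have b: "b \<ge> 0" using X by (simp add: b_def psd_mats_def)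
  have "0 \<le> (x + c *\<^sub>R y) \<bullet> (X *v (x + c *\<^sub>R y))" for c
    using X by (simp add: psd_mats_def)
  moreover have "(x + c *\<^sub>R y) \<bullet> (X *v (x + c *\<^sub>R y)) \<le> 2 * c * (y \<bullet> y) + c\<^sup>2 * b" for c
    using X x by (simp add: psd_mats_def sym_quadratic_expand b_def) (simp add: y_def)
  ultimately have *: "0 \<le> 2 * c * (y \<bullet> y) + c\<^sup>2 * b" for c
    by (meson order_trans)
  \<comment> \<open>The choice c = -(y \<bullet> y) / (b + 1) is nearly the minimiser of the
    quadratic; b + 1 instead of b keeps the denominator positive when b = 0.\<close>
  have "0 \<le> 2 * (- (y\<bullet>y) / (b+1)) * (y \<bullet> y) + (- (y\<bullet>y) / (b+1))\<^sup>2 * b" by (rule *)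
  also have "\<dots> = (y\<bullet>y)\<^sup>2 / (b+1)\<^sup>2 * (b - 2 * (b+1))"
    using b by (simp add: power2_eq_square divide_simps) (simp add: algebra_simps)
  finally have "0 \<le> (y\<bullet>y)\<^sup>2 / (b+1)\<^sup>2 * (b - 2 * (b+1))" .
  moreover have "(y\<bullet>y)\<^sup>2 / (b+1)\<^sup>2 > 0" using y b by simp
  ultimately have "0 \<le> b - 2 * (b+1)" by (simp only: zero_le_mult_iff) linarith
  then show False using b by simp
qed

lemma pd_imp_psd: "X \<in> pd_mats \<Longrightarrow> X \<in> psd_mats"
  unfolding pd_mats_def psd_mats_def pos_form_def
  by (clarsimp, metis inner_zero_left less_imp_le order_refl)

lemma pd_imp_invertible:
  assumes "X \<in> pd_mats" shows "invertible X"
proof -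
  have "x = 0" if "X *v x = 0" for x
    using assms that by (force simp: pd_mats_def pos_form_def)
  then show ?thesis
    using matrix_left_invertible_ker invertible_left_inverse by blast
qed

lemma pd_matrix_inv:
  assumes "X \<in> pd_mats" shows "matrix_inv X \<in> pd_mats"
proof -
  note inv = pd_imp_invertible[OF assms]
  have "transpose (matrix_inv X) = matrix_inv X"
    using assms by (simp add: transpose_matrix_inv[OF inv] pd_mats_def sym_mats_def)
  moreover have "0 < x \<bullet> (matrix_inv X *v x)" if "x \<noteq> 0" for x
  proof -
    define y where "y = matrix_inv X *v x"
    have x: "x = X *v y"
      by (simp add: y_def matrix_vector_mul_assoc matrix_inv_right_inverse[OF inv])
    then have "y \<noteq> 0" using that by auto
    then have "0 < y \<bullet> (X *v y)" using assms by (simp add: pd_mats_def pos_form_def)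
    then have "0 < y \<bullet> x" by (simp flip: x)
    then show ?thesis by (simp add: inner_commute flip: y_def)
  qed
  ultimately show ?thesis by (simp add: pd_mats_def sym_mats_def pos_form_def)
qed

lemma psd_congruence:
  assumes "X \<in> psd_mats" shows "A ** X ** transpose A \<in> psd_mats"
proof -
  have "x \<bullet> (A ** X ** transpose A *v x) = (transpose A *v x) \<bullet> (X *v (transpose A *v x))" for x
    using inner_matrix_transpose[of x A "X *v (transpose A *v x)"]
    by (simp flip: matrix_vector_mul_assoc)
  then show ?thesis
    using assms by (simp add: psd_mats_def sym_mats_def matrix_transpose_mul matrix_mul_assoc)
qed

lemma psd_add: "X \<in> psd_mats \<Longrightarrow> Y \<in> psd_mats \<Longrightarrow> X + Y \<in> psd_mats"
  by (auto simp: psd_mats_def sym_mats_def transpose_simps matrix_vector_simps inner_simps)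

lemma psd_scaleR: "X \<in> psd_mats \<Longrightarrow> c \<ge> 0 \<Longrightarrow> c *\<^sub>R X \<in> psd_mats"
  by (auto simp: psd_mats_def sym_mats_def transpose_simps matrix_vector_simps)

lemma psd_zero: "0 \<in> psd_mats"
  by (auto simp: psd_mats_def sym_mats_def transpose_def vec_eq_iff matrix_vector_simps)

lemma psd_mat_1: "mat 1 \<in> psd_mats"
  by (auto simp: psd_mats_def sym_mats_def)

text \<open>Together with convexity this makes the nearest-point projection onto the cone well
  defined and nonexpansive, as the truncation requires.\<close>

lemma closed_psd: "closed (psd_mats :: (real^'n^'n) set)"
proof -
  have "closed {X :: real^'n^'n. transpose X = X}"
    by (intro closed_Collect_eq continuous_intros)
  moreover have "closed {X :: real^'n^'n. \<forall>x. 0 \<le> x \<bullet> (X *v x)}"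
    by (intro closed_Collect_all closed_Collect_le continuous_intros)
  ultimately show ?thesis
    using closed_Int by (fastforce simp: psd_mats_def sym_mats_def Collect_conj_eq)
qed

lemma convex_psd: "convex (psd_mats :: (real^'n^'n) set)"
  by (rule convexI) (intro psd_add psd_scaleR)

text \<open>Compactness of the unit sphere: \<beta> is the minimum of the form there, that is, the
  smallest eigenvalue.\<close>

lemma pd_imp_coercive:
  assumes X: "(X :: real^'n^'n) \<in> pd_mats"
  obtains \<beta> where "\<beta> > 0" "\<And>v. \<beta> * (v \<bullet> v) \<le> v \<bullet> (X *v v)"
proof -
  obtain w where w: "w \<in> sphere 0 1" "\<And>v. v \<in> sphere 0 1 \<Longrightarrow> w \<bullet> (X *v w) \<le> v \<bullet> (X *v v)"
  proof (rule bexE[OF continuous_attains_inf[of "sphere 0 1" "\<lambda>v. v \<bullet> (X *v v)"]])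
    show "continuous_on (sphere 0 1) (\<lambda>v. v \<bullet> (X *v v))"
      by (intro continuous_intros)
  qed (use that in auto)
  define \<beta> where "\<beta> = w \<bullet> (X *v w)"
  have "w \<noteq> 0" using w(1) by auto
  then have "\<beta> > 0" using X by (simp add: \<beta>_def pd_mats_def pos_form_def)
  moreover have "\<beta> * (v \<bullet> v) \<le> v \<bullet> (X *v v)" for v
  proof (cases "v = 0")
    case False
    have "\<beta> \<le> (v /\<^sub>R norm v) \<bullet> (X *v (v /\<^sub>R norm v))"
      unfolding \<beta>_def by (rule w) (use False in simp)
    also have "\<dots> = (v \<bullet> (X *v v)) / (v \<bullet> v)"
      by (simp add: matrix_vector_simps dot_square_norm power2_eq_square divide_simps)
    finally show ?thesis using False by (simp add: pos_le_divide_eq)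
  qed (simp add: matrix_vector_simps)
  ultimately show ?thesis by (rule that)
qed

section \<open>The trace as a substitute for the norm on the cone, and bounds for inverses\<close>

lemma abs_trace_le: "\<bar>trace (X :: real^'n^'n)\<bar> \<le> real CARD('n) * norm X"
proof -
  have "\<bar>X $ i $ i\<bar> \<le> norm X" for i
    using order_trans[OF component_le_norm_cart Finite_Cartesian_Product.norm_nth_le] .
  then have "\<bar>trace X\<bar> \<le> (\<Sum>i\<in>(UNIV :: 'n set). norm X)"
    unfolding trace_def by (intro order_trans[OF sum_abs] sum_mono)
  then show ?thesis by simp
qed

lemma bounded_linear_trace: "bounded_linear (trace :: real^'n^'n \<Rightarrow> real)"
  by (rule bounded_linear_intro[of _ "real CARD('n)"])
    (use abs_trace_le in \<open>auto simp: trace_def sum.distrib sum_distrib_left mult.commute\<close>)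

lemma matrix_diag_nonneg: "X \<in> psd_mats \<Longrightarrow> 0 \<le> X $ i $ i"
  using matrix_mult_axis[of X i] by (auto simp: psd_mats_def inner_axis' column_def dest: spec[of _ "axis i 1"])

lemma trace_psd_nonneg: "X \<in> psd_mats \<Longrightarrow> 0 \<le> trace X"
  by (simp add: trace_def sum_nonneg matrix_diag_nonneg)

text \<open>Testing the form on e_i + e_j and e_i - e_j bounds an off-diagonal entry by the mean of
  two diagonal ones, each at most the trace. The factor counts the entries.\<close>

lemma norm_psd_le_trace:
  assumes X: "(X :: real^'n^'n) \<in> psd_mats"
  shows "norm X \<le> (real CARD('n))\<^sup>2 * trace X"
proof -
  have entry: "\<bar>X $ i $ j\<bar> \<le> trace X" for i j
  proof -
    have d: "0 \<le> X $ k $ k" for k using X by (rule matrix_diag_nonneg)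
    have le: "X $ k $ k \<le> trace X" for k
      unfolding trace_def by (rule member_le_sum) (use d in auto)
    have *: "0 \<le> X $ i $ i + 2 * c * X $ j $ i + c\<^sup>2 * X $ j $ j" for c
    proof -
      have "0 \<le> (axis i 1 + c *\<^sub>R axis j 1) \<bullet> (X *v (axis i 1 + c *\<^sub>R axis j 1))"
        using X by (simp add: psd_mats_def)
      then show ?thesis using X
        by (simp add: sym_quadratic_expand psd_mats_def matrix_mult_axis inner_axis' column_def)
    qed
    have "X $ i $ j = X $ j $ i" using X by (auto simp: psd_mats_def sym_mats_def transpose_def vec_eq_iff)
    then show ?thesis using *[of 1] *[of "-1"] le[of i] le[of j] by (simp add: power2_eq_square)
  qed
  have "norm X \<le> (\<Sum>i\<in>UNIV. norm (X $ i))" by (simp add: norm_vec_def L2_set_le_sum)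
  also have "\<dots> \<le> (\<Sum>i\<in>(UNIV::'n set). \<Sum>j\<in>(UNIV::'n set). \<bar>X $ i $ j\<bar>)"
    by (intro sum_mono norm_le_l1_cart)
  also have "\<dots> \<le> (\<Sum>i\<in>(UNIV::'n set). \<Sum>j\<in>(UNIV::'n set). trace X)"
    by (intro sum_mono entry)
  finally show ?thesis by (simp add: power2_eq_square mult.assoc)
qed

lemma coercive_pd:
  assumes X: "X - c *\<^sub>R mat 1 \<in> psd_mats" and c: "c > 0"
  shows "X \<in> pd_mats"
proof -
  have "X = (X - c *\<^sub>R mat 1) + c *\<^sub>R mat 1" by simp
  with psd_add[OF X psd_scaleR[OF psd_mat_1, of c]] c have "X \<in> sym_mats"
    by (simp add: psd_mats_def)
  moreover have "0 < x \<bullet> (X *v x)" if "x \<noteq> 0" for x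
  proof -
    have "0 \<le> x \<bullet> ((X - c *\<^sub>R mat 1) *v x)" using X by (simp add: psd_mats_def)
    then have "c * (x \<bullet> x) \<le> x \<bullet> (X *v x)" by (simp add: matrix_vector_simps inner_simps)
    then show ?thesis using c that by (meson inner_gt_zero_iff less_le_trans mult_pos_pos)
  qed
  ultimately show ?thesis by (simp add: pd_mats_def pos_form_def)
qed

text \<open>Cauchy-Schwarz bounds the inverse by 1 / c on vectors. The norm here is the Frobenius
  norm, so the bound is applied to each row; by symmetry a row is the image of a unit vector, and
  summing rows gives the dimension factor.\<close>

lemma norm_matrix_inv_coercive:
  fixes X :: "real^'n^'n"
  assumes X: "X - c *\<^sub>R mat 1 \<in> psd_mats" and c: "c > 0"
  shows "norm (matrix_inv X) \<le> CARD('n) / c"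
proof -
  have pd: "X \<in> pd_mats" by (rule coercive_pd[OF assms])
  note inv = pd_imp_invertible[OF pd]
  have vec: "norm (matrix_inv X *v w) \<le> norm w / c" for w
  proof (cases "matrix_inv X *v w = 0")
    case False
    define y where "y = matrix_inv X *v w"
    have w: "w = X *v y"
      by (simp add: y_def matrix_vector_mul_assoc matrix_inv_right_inverse[OF inv])
    have "0 \<le> y \<bullet> ((X - c *\<^sub>R mat 1) *v y)" using X by (simp add: psd_mats_def)
    then have "c * (y \<bullet> y) \<le> y \<bullet> w" by (simp add: matrix_vector_simps inner_simps w)
    also have "\<dots> \<le> norm y * norm w" by (rule norm_cauchy_schwarz)
    finally have "norm y * (c * norm y) \<le> norm y * norm w"
      by (simp add: dot_square_norm power2_eq_square mult.left_commute)
    then have "c * norm y \<le> norm w" by (rule mult_left_le_imp_le) (use False in \<open>simp add: y_def\<close>)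
    then show ?thesis using c by (simp add: y_def pos_le_divide_eq mult.commute)
  qed (use c in simp)
  have sym: "transpose (matrix_inv X) = matrix_inv X"
    using pd_matrix_inv[OF pd] by (simp add: pd_mats_def sym_mats_def)
  have "matrix_inv X $ i = matrix_inv X *v axis i 1" for i
  proof -
    have "matrix_inv X $ i = column i (transpose (matrix_inv X))"
      by (simp add: column_def transpose_def vec_eq_iff)
    then show ?thesis by (simp add: sym matrix_mult_axis)
  qed
  then have row: "norm (matrix_inv X $ i) \<le> 1 / c" for i
    using vec[of "axis i 1"] by (simp add: norm_axis_1)
  have "norm (matrix_inv X) \<le> (\<Sum>i\<in>UNIV. norm (matrix_inv X $ i))"
    by (simp add: norm_vec_def L2_set_le_sum)
  also have "\<dots> \<le> (\<Sum>i\<in>(UNIV::'n set). 1 / c)" by (intro sum_mono row)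
  finally show ?thesis by simp
qed

section \<open>Integral equations with a small delay\<close>

text \<open>Qualitative companion of \<open>bdd_meas_on\<close>: with no bound to track, the class
  is closed under arbitrary continuous operations, including inversion and projections.\<close>

definition bounded_measurable :: "real set \<Rightarrow> (real \<Rightarrow> 'a::euclidean_space) \<Rightarrow> bool" where
  "bounded_measurable S f \<longleftrightarrow> f \<in> borel_measurable (lebesgue_on S) \<and> bounded (f ` S)"

lemma bdd_meas_on_imp: "bdd_meas_on S K f \<Longrightarrow> bounded_measurable S f"
  by (auto simp: bdd_meas_on_def bounded_measurable_def bounded_iff)

lemma bounded_measurable_compose:
  fixes h :: "'a::euclidean_space \<Rightarrow> 'b::euclidean_space"
  assumes h: "continuous_on UNIV h" and f: "bounded_measurable S f"
  shows "bounded_measurable S (\<lambda>t. h (f t))"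
  unfolding bounded_measurable_def
proof
  show "(\<lambda>t. h (f t)) \<in> borel_measurable (lebesgue_on S)"
    using f by (intro borel_measurable_continuous_on[OF h]) (simp add: bounded_measurable_def)
  have "compact (closure (f ` S))" using f by (simp add: bounded_measurable_def)
  then have "bounded (h ` closure (f ` S))"
    by (meson h compact_continuous_image compact_imp_bounded continuous_on_subset subset_UNIV)
  then show "bounded ((\<lambda>t. h (f t)) ` S)"
    by (rule bounded_subset) (use closure_subset in fastforce)
qed

lemma bounded_measurable_Pair:
  assumes "bounded_measurable S f" "bounded_measurable S g"
  shows "bounded_measurable S (\<lambda>t. (f t, g t))"
proof -
  have "bounded ((\<lambda>t. (f t, g t)) ` S)"
    by (rule bounded_subset[OF bounded_Times[of "f ` S" "g ` S"]])
      (use assms in \<open>auto simp: bounded_measurable_def\<close>)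
  then show ?thesis
    using assms by (simp add: bounded_measurable_def borel_measurable_Pair)
qed

lemma bounded_measurable_compose2:
  fixes h :: "'a::euclidean_space \<Rightarrow> 'b::euclidean_space \<Rightarrow> 'c::euclidean_space"
  assumes "continuous_on UNIV (\<lambda>p. h (fst p) (snd p))"
    and "bounded_measurable S f" "bounded_measurable S g"
  shows "bounded_measurable S (\<lambda>t. h (f t) (g t))"
  using bounded_measurable_compose[OF assms(1) bounded_measurable_Pair[OF assms(2,3)]] by simp

lemma bounded_measurable_add:
    "bounded_measurable S f \<Longrightarrow> bounded_measurable S g \<Longrightarrow> bounded_measurable S (\<lambda>t. f t + g t)"
  and bounded_measurable_diff:
    "bounded_measurable S f \<Longrightarrow> bounded_measurable S g \<Longrightarrow> bounded_measurable S (\<lambda>t. f t - g t)"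
  and bounded_measurable_uminus: "bounded_measurable S f \<Longrightarrow> bounded_measurable S (\<lambda>t. - f t)"
  and bounded_measurable_scaleR: "bounded_measurable S f \<Longrightarrow> bounded_measurable S (\<lambda>t. c *\<^sub>R f t)"
  by (rule bounded_measurable_compose2 bounded_measurable_compose; (assumption | intro continuous_intros))+

lemma bounded_measurable_matrix_mult:
    "bounded_measurable S f \<Longrightarrow> bounded_measurable S g \<Longrightarrow> bounded_measurable S (\<lambda>t. f t ** g t)"
  and bounded_measurable_transpose:
    "bounded_measurable S f \<Longrightarrow> bounded_measurable S (\<lambda>t. transpose (f t))"
  for f :: "real \<Rightarrow> real^'m^'n" and g :: "real \<Rightarrow> real^'k^'m"
  by (rule bounded_measurable_compose2 bounded_measurable_compose; (assumption | intro continuous_intros))+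

lemma bounded_measurable_const: "bounded_measurable S (\<lambda>_. c)"
  by (auto simp: bounded_measurable_def bounded_iff)

lemma bounded_measurable_continuous:
  "continuous_on {a..b} f \<Longrightarrow> bounded_measurable {a..b::real} f"
  by (auto simp: bounded_measurable_def compact_continuous_image compact_imp_bounded
      intro: continuous_imp_measurable_on_sets_lebesgue)

lemmas bounded_measurable_intros =
  bounded_measurable_add bounded_measurable_diff bounded_measurable_uminus
  bounded_measurable_scaleR bounded_measurable_matrix_mult bounded_measurable_transpose
  bounded_measurable_const

lemma bounded_measurable_subset:
  assumes f: "bounded_measurable A f" and "B \<subseteq> A"
  shows "bounded_measurable B f"
  unfolding bounded_measurable_def
proof
  show "f \<in> borel_measurable (lebesgue_on B)"
    by (rule measurable_restrict_mono[OF _ \<open>B \<subseteq> A\<close>]) (use f in \<open>simp add: bounded_measurable_def\<close>)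
  show "bounded (f ` B)"
    by (rule bounded_subset[OF _ image_mono[OF \<open>B \<subseteq> A\<close>]]) (use f in \<open>simp add: bounded_measurable_def\<close>)
qed

lemma bounded_measurable_integrable:
  assumes f: "bounded_measurable {a..b} f" and sub: "{c..d} \<subseteq> {a..b}"
  shows "f integrable_on {c..d}"
proof -
  have cd: "bounded_measurable {c..d} f" by (rule bounded_measurable_subset[OF f sub])
  then obtain K where "\<forall>x\<in>f ` {c..d}. norm x \<le> K"
    unfolding bounded_measurable_def bounded_iff by blast
  then show ?thesis
    using cd by (intro measurable_bounded_by_integrable_imp_integrable[of f _ "\<lambda>_. K"])
      (auto simp: bounded_measurable_def)
qed

text \<open>The history is a constant J supplied separately, so only the values of X on [s,T] enter,
  and a jump at s is built in.\<close>

definition delayed :: "real \<Rightarrow> real \<Rightarrow> 'a \<Rightarrow> (real \<Rightarrow> 'a) \<Rightarrow> real \<Rightarrow> 'a" where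
  "delayed s \<delta> J X t = (if t - \<delta> < s then J else X (t - \<delta>))"

lemma bounded_measurable_delayed:
  assumes X: "continuous_on {s..T} X" and "\<delta> > 0"
  shows "bounded_measurable {s..T} (delayed s \<delta> J X)"
  unfolding bounded_measurable_def
proof
  have "bounded (insert J (X ` {s..T}))"
    using X by (simp add: compact_continuous_image compact_imp_bounded)
  then show "bounded (delayed s \<delta> J X ` {s..T})"
    by (rule bounded_subset) (use \<open>\<delta> > 0\<close> in \<open>auto simp: delayed_def\<close>)
  have "continuous_on {s..T} (\<lambda>t. X (max s (t - \<delta>)))"
    by (rule continuous_on_compose2[OF X]) (use \<open>\<delta> > 0\<close> in \<open>auto intro!: continuous_intros\<close>)
  then have [measurable]: "(\<lambda>t. X (max s (t - \<delta>))) \<in> borel_measurable (lebesgue_on {s..T})"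
    by (rule continuous_imp_measurable_on_sets_lebesgue) simp
  \<comment> \<open>The jump at s + \<delta> rules out continuity. Clamping the argument at s gives
    a function continuous on all of [s,T], which is then glued to the constant J.\<close>
  have "delayed s \<delta> J X = (\<lambda>t. if t < s + \<delta> then J else X (max s (t - \<delta>)))"
    by (auto simp: delayed_def fun_eq_iff)
  moreover have "(\<lambda>t. if t < s + \<delta> then J else X (max s (t - \<delta>))) \<in> borel_measurable (lebesgue_on {s..T})"
  proof -
    have "{..<s + \<delta>} \<inter> {s..T} \<in> sets (lebesgue_on {s..T})"
      by (auto simp: sets_restrict_space intro!: image_eqI[of _ _ "{..<s + \<delta>}"])
    then have "(\<lambda>t. if t \<in> {..<s + \<delta>} then J else X (max s (t - \<delta>))) \<in> borel_measurable (lebesgue_on {s..T})"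
      by (intro measurable_If_set) auto
    then show ?thesis by simp
  qed
  ultimately show "delayed s \<delta> J X \<in> borel_measurable (lebesgue_on {s..T})" by simp
qed

section \<open>The exponential weight, the contraction and its consequences\<close>

lemma has_integral_exp_weight:
  fixes \<theta> :: real
  assumes "\<theta> \<noteq> 0" "t \<le> T"
  shows "((\<lambda>r. exp (\<theta> * (T - r))) has_integral (exp (\<theta> * (T - t)) - 1) / \<theta>) {t..T}"
proof -
  have "((\<lambda>r. - exp (\<theta> * (T - r)) / \<theta>) has_vector_derivative exp (\<theta> * (T - r))) (at r within {t..T})" for r
    using assms unfolding has_real_derivative_iff_has_vector_derivative[symmetric]
    by (auto intro!: derivative_eq_intros)
  from fundamental_theorem_of_calculus[OF \<open>t \<le> T\<close> this] show ?thesis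
    by (simp add: diff_divide_distrib)
qed

lemma exp_weight_shift:
  fixes \<theta> :: real
  assumes "exp (\<theta> * \<delta>) \<le> 2"
  shows "exp (\<theta> * (T - (r - \<delta>))) \<le> 2 * exp (\<theta> * (T - r))"
proof -
  have "exp (\<theta> * (T - (r - \<delta>))) = exp (\<theta> * \<delta>) * exp (\<theta> * (T - r))"
    by (simp add: algebra_simps flip: exp_add)
  then show ?thesis using assms by simp
qed

text \<open>Backwards in time the delay is an advance, so no Gronwall argument applies; but in the sup
  norm with weight \<open>exp (\<theta> * (t - T))\<close> an advance by \<open>\<delta>\<close> only costs the factor
  \<open>exp (\<theta> * \<delta>) \<le> 2\<close>, and the integral operator halves the norm.\<close>

lemma delayed_integral_inequality:
  fixes x :: "real \<Rightarrow> real"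
  assumes sT: "s \<le> T" and \<delta>: "\<delta> > 0" and nonneg: "0 \<le> k" "0 \<le> l" "0 \<le> g" "0 \<le> c" "0 \<le> m"
    and \<theta>: "\<theta> > 0" "2 * (k + 2 * l) \<le> \<theta>" "exp (\<theta> * \<delta>) \<le> 2"
    and x: "continuous_on {s..T} x" "\<And>t. t \<in> {s..T} \<Longrightarrow> 0 \<le> x t"
    and step: "\<And>t \<phi> I. t \<in> {s..T} \<Longrightarrow> (\<phi> has_integral I) {t..T} \<Longrightarrow>
        (\<And>r. r \<in> {t..T} \<Longrightarrow> k * x r + l * delayed s \<delta> c x r + g \<le> \<phi> r) \<Longrightarrow> x t \<le> m + I"
    and t: "t \<in> {s..T}"
  shows "x t \<le> 2 * (m + (T - s) * (g + l * c)) * exp (\<theta> * (T - s))"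
proof -
  \<comment> \<open>The maximum W of the weighted function is attained at some t0; estimating x at
    t0 alone bounds W, and W bounds x everywhere.\<close>
  have "continuous_on {s..T} (\<lambda>t. exp (\<theta> * (t - T)) * x t)"
    by (intro continuous_intros x)
  then obtain t0 where t0: "t0 \<in> {s..T}"
    and max: "\<And>t. t \<in> {s..T} \<Longrightarrow> exp (\<theta> * (t - T)) * x t \<le> exp (\<theta> * (t0 - T)) * x t0"
    using continuous_attains_sup[of "{s..T}"] sT by fastforce
  define W where "W = exp (\<theta> * (t0 - T)) * x t0"
  define e where "e r = exp (\<theta> * (T - r))" for r
  define m' where "m' = m + (T - s) * (g + l * c)"
  have W0: "W \<ge> 0" using x(2)[OF t0] by (simp add: W_def)
  have e_inv: "e r * exp (\<theta> * (r - T)) = 1" for r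
    by (simp add: e_def algebra_simps flip: exp_add)
  have e1: "e r \<ge> 1" if "r \<le> T" for r
    using that \<theta> by (simp add: e_def)
  have bound: "x r \<le> W * e r" if "r \<in> {s..T}" for r
  proof -
    have "e r * (exp (\<theta> * (r - T)) * x r) \<le> e r * W"
      unfolding W_def by (rule mult_left_mono[OF max[OF that]]) (simp add: e_def)
    moreover have "e r * (exp (\<theta> * (r - T)) * x r) = x r"
      by (simp add: e_inv flip: mult.assoc)
    ultimately have "x r \<le> e r * W" by (simp only:)
    then show ?thesis by (simp add: mult.commute)
  qed
  have "x t0 = e t0 * exp (\<theta> * (t0 - T)) * x t0" by (simp add: e_inv)
  then have xt0: "x t0 = W * e t0" unfolding W_def by (simp add: mult.assoc mult.commute)
  \<comment> \<open>Hypothesis \<open>step\<close> accepts any integrable majorant. Taking an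
    explicit exponential, with integral I, avoids integrating the discontinuous delayed function
    itself.\<close>
  define I where "I = (T - t0) * (g + l * c) + W * (k + 2 * l) * ((e t0 - 1) / \<theta>)"
  have "x t0 \<le> m + I"
  proof (rule step[OF t0])
    have c: "((\<lambda>r. g + l * c) has_integral ((T - t0) * (g + l * c))) {t0..T}"
      using t0 has_integral_const_real[of "g + l * c" t0 T] by simp
    show "((\<lambda>r. (g + l * c) + W * (k + 2 * l) * e r) has_integral I) {t0..T}"
      unfolding I_def e_def
      by (intro has_integral_add has_integral_mult_right c has_integral_exp_weight) (use \<theta> t0 in auto)
    fix r assume r: "r \<in> {t0..T}"
    have "delayed s \<delta> c x r \<le> c + 2 * (W * e r)"
    proof (cases "r - \<delta> < s")
      case True
      then show ?thesis using W0 by (simp add: delayed_def e_def)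
    next
      case False
      then have "x (r - \<delta>) \<le> W * e (r - \<delta>)" by (intro bound) (use r \<delta> in auto)
      also have "\<dots> \<le> W * (2 * e r)"
        using W0 exp_weight_shift[OF \<theta>(3)] unfolding e_def by (intro mult_left_mono)
      finally show ?thesis using False nonneg by (simp add: delayed_def)
    qed
    then have "l * delayed s \<delta> c x r \<le> l * (c + 2 * (W * e r))"
      by (rule mult_left_mono[OF _ \<open>0 \<le> l\<close>])
    moreover have "k * x r \<le> k * (W * e r)"
      by (rule mult_left_mono[OF bound]) (use r t0 nonneg in auto)
    ultimately show "k * x r + l * delayed s \<delta> c x r + g \<le> (g + l * c) + W * (k + 2 * l) * e r"
      by (simp add: algebra_simps)
  qed
  also have "\<dots> \<le> m' + W * e t0 / 2"
  proof -
    have "(T - t0) * (g + l * c) \<le> (T - s) * (g + l * c)"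
      by (rule mult_right_mono) (use t0 nonneg in auto)
    \<comment> \<open>Since k + 2 l is at most \<theta> / 2, the integral of the weight returns at
      most half of W * e t0, which the left side absorbs.\<close>
    moreover have "(k + 2 * l) * ((e t0 - 1) / \<theta>) \<le> (\<theta> / 2) * ((e t0 - 1) / \<theta>)"
      using \<theta> e1[of t0] t0 by (intro mult_right_mono) auto
    then have "W * ((k + 2 * l) * ((e t0 - 1) / \<theta>)) \<le> W * (e t0 / 2)"
      using W0 \<theta> by (intro mult_left_mono) auto
    moreover have "I = (T - t0) * (g + l * c) + W * ((k + 2 * l) * ((e t0 - 1) / \<theta>))"
      unfolding I_def by (simp only: mult.assoc)
    moreover have "W * (e t0 / 2) = W * e t0 / 2" by simp
    ultimately show ?thesis unfolding m'_def by linarith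
  qed
  finally have "W * e t0 \<le> 2 * m'" by (simp add: xt0)
  moreover have "W * 1 \<le> W * e t0" using W0 e1[of t0] t0 by (intro mult_left_mono) auto
  ultimately have W: "W \<le> 2 * m'" by simp
  have "x t \<le> W * e t" by (rule bound[OF t])
  also have "\<dots> \<le> 2 * m' * e s"
    using t \<theta> W0 W by (intro mult_mono) (auto simp: e_def)
  finally show ?thesis by (simp add: m'_def e_def)
qed

text \<open>The unknown in Banach's theorem is the weighted function, so that the ordinary sup
  metric on bounded continuous functions is the weighted one; \<open>u\<close> undoes the weight and
  \<open>G\<close> is the integral operator in the new variable.\<close>

lemma delay_equation_exists:
  fixes F :: "real \<Rightarrow> 'e::euclidean_space \<Rightarrow> 'e \<Rightarrow> 'e"
  assumes sT: "s \<le> T" and \<delta>: "\<delta> > 0" and nonneg: "0 \<le> k" "0 \<le> l"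
    and \<theta>: "\<theta> > 0" "2 * (k + 2 * l) \<le> \<theta>" "exp (\<theta> * \<delta>) \<le> 2"
    and lip: "\<And>t x x' y y'. t \<in> {s..T} \<Longrightarrow>
        norm (F t x y - F t x' y') \<le> k * norm (x - x') + l * norm (y - y')"
    and int: "\<And>x. continuous_on {s..T} x \<Longrightarrow> (\<lambda>r. F r (x r) (delayed s \<delta> J x r)) integrable_on {s..T}"
  obtains X where "continuous_on {s..T} X"
    "\<And>t. t \<in> {s..T} \<Longrightarrow> ((\<lambda>r. F r (X r) (delayed s \<delta> J X r)) has_integral (X t - M)) {t..T}"
proof -
  define u where "u y r = exp (\<theta> * (T - r)) *\<^sub>R (apply_bcontfun y r :: 'e)" for y r
  define f where "f y r = F r (u y r) (delayed s \<delta> J (u y) r)" for y r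
  define G where "G y t = exp (\<theta> * (t - T)) *\<^sub>R (M + integral {t..T} (f y))" for y t
  have u_cont: "continuous_on {s..T} (u y)" for y
    unfolding u_def by (intro continuous_intros continuous_on_apply_bcontfun)
  have f_int: "f y integrable_on {s..T}" for y
    unfolding f_def by (rule int[OF u_cont])
  have f_int': "f y integrable_on {t..T}" if "t \<in> {s..T}" for y t
    by (rule integrable_on_subinterval[OF f_int]) (use that in auto)
  have "continuous_on {s..T} (G y)" for y
    unfolding G_def by (intro continuous_intros indefinite_integral_continuous_1' f_int)
  \<comment> \<open>Clamping extends the image constantly beyond [s,T], producing a bounded
    continuous function on the whole line without changing distances measured on [s,T].\<close>
  then have "\<exists>g :: real \<Rightarrow>\<^sub>C 'e. \<forall>t. g t = G y (clamp s T t)" for y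
    using continuous_on_cbox_bcontfunE[of s T "G y"] by (metis cbox_interval)
  then obtain \<Phi> where \<Phi>: "\<And>y t. apply_bcontfun (\<Phi> y) t = G y (clamp s T t)" by metis
  have contr: "dist (G y t) (G z t) \<le> 1/2 * dist y z" if t: "t \<in> {s..T}" for y z t
  proof -
    define d where "d = dist y z"
    define e where "e r = exp (\<theta> * (T - r))" for r
    have yz: "norm (apply_bcontfun y r - apply_bcontfun z r) \<le> d" for r
      unfolding d_def using dist_bounded[of y r z] by (simp add: dist_norm)
    have uu: "norm (u y r - u z r) \<le> d * e r" for r
    proof -
      have "norm (u y r - u z r) = e r * norm (apply_bcontfun y r - apply_bcontfun z r)"
        by (simp add: u_def e_def flip: scaleR_diff_right)
      then show ?thesis using yz by (simp add: e_def mult.commute)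
    qed
    have dd: "norm (delayed s \<delta> J (u y) r - delayed s \<delta> J (u z) r) \<le> 2 * d * e r" for r
    proof (cases "r - \<delta> < s")
      case False
      have "norm (u y (r - \<delta>) - u z (r - \<delta>)) \<le> d * e (r - \<delta>)" by (rule uu)
      also have "\<dots> \<le> d * (2 * e r)"
        unfolding e_def by (intro mult_left_mono exp_weight_shift \<theta>) (simp add: d_def)
      finally show ?thesis using False by (simp add: delayed_def)
    qed (simp add: delayed_def d_def e_def)
    have ff: "norm (f y r - f z r) \<le> (k + 2 * l) * d * e r" if "r \<in> {s..T}" for r
    proof -
      have "norm (f y r - f z r) \<le> k * norm (u y r - u z r)
          + l * norm (delayed s \<delta> J (u y) r - delayed s \<delta> J (u z) r)"
        unfolding f_def by (rule lip[OF that])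
      also have "\<dots> \<le> k * (d * e r) + l * (2 * d * e r)"
        using uu dd nonneg by (intro add_mono mult_left_mono)
      finally show ?thesis by (simp add: algebra_simps)
    qed
    have ew: "((\<lambda>r. (k + 2 * l) * d * e r) has_integral (k + 2 * l) * d * ((e t - 1) / \<theta>)) {t..T}"
      unfolding e_def
      by (intro has_integral_mult_right has_integral_exp_weight) (use \<theta> t in auto)
    have "norm (integral {t..T} (f y) - integral {t..T} (f z))
        = norm (integral {t..T} (\<lambda>r. f y r - f z r))"
      using f_int'[OF t] by (simp add: integral_diff)
    also have "\<dots> \<le> integral {t..T} (\<lambda>r. (k + 2 * l) * d * e r)"
      by (intro integral_norm_bound_integral integrable_diff f_int' t ff)
        (use t ew in \<open>auto simp: integrable_on_def\<close>)
    also have "\<dots> = (k + 2 * l) * (d * ((e t - 1) / \<theta>))"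
      unfolding integral_unique[OF ew] by (rule mult.assoc)
    also have "\<dots> \<le> (\<theta> / 2) * (d * ((e t - 1) / \<theta>))"
      by (rule mult_right_mono) (use \<theta> t in \<open>auto simp: d_def e_def\<close>)
    also have "\<dots> = d / 2 * (e t - 1)" using \<theta> by simp
    also have "\<dots> \<le> d / 2 * e t"
      by (intro mult_left_mono) (simp_all add: d_def)
    finally have *: "norm (integral {t..T} (f y) - integral {t..T} (f z)) \<le> d / 2 * e t" .
    have "dist (G y t) (G z t)
        = exp (\<theta> * (t - T)) * norm (integral {t..T} (f y) - integral {t..T} (f z))"
      by (simp add: G_def dist_norm flip: scaleR_diff_right)
    also have "\<dots> \<le> exp (\<theta> * (t - T)) * (d / 2 * e t)"
      by (rule mult_left_mono[OF *]) simp
    also have "\<dots> = d / 2 * (exp (\<theta> * (t - T)) * e t)" by simp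
    also have "exp (\<theta> * (t - T)) * e t = 1" by (simp add: e_def algebra_simps flip: exp_add)
    finally show ?thesis by (simp add: d_def)
  qed
  have "dist (\<Phi> y) (\<Phi> z) \<le> 1/2 * dist y z" for y z
    by (rule dist_bound) (use contr sT clamp_in_interval[of s T] in \<open>auto simp: \<Phi>\<close>)
  then obtain y where y: "\<Phi> y = y"
    using banach_fix_type[of "1/2" \<Phi>] by auto
  have "u y t = M + integral {t..T} (f y)" if "t \<in> {s..T}" for t
  proof -
    have "apply_bcontfun y t = G y t"
      using \<Phi>[of y t] that clamp_cancel_cbox[of t s T] by (simp add: y)
    then have "u y t = (exp (\<theta> * (T - t)) * exp (\<theta> * (t - T))) *\<^sub>R (M + integral {t..T} (f y))"
      by (simp add: u_def G_def)
    then show ?thesis by (simp add: algebra_simps flip: exp_add)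
  qed
  then have "((\<lambda>r. F r (u y r) (delayed s \<delta> J (u y) r)) has_integral (u y t - M)) {t..T}"
    if "t \<in> {s..T}" for t
    using integrable_integral[OF f_int'[OF that]] that unfolding f_def by simp
  with u_cont show ?thesis by (rule that)
qed

text \<open>The norm of the difference of two solutions obeys the weighted inequality with zero
  terminal value, zero history and zero source, so the resulting bound is zero.\<close>

lemma delay_equation_unique:
  fixes F :: "real \<Rightarrow> 'e::euclidean_space \<Rightarrow> 'e \<Rightarrow> 'e"
  assumes sT: "s \<le> T" and \<delta>: "\<delta> > 0" and nonneg: "0 \<le> k" "0 \<le> l"
    and \<theta>: "\<theta> > 0" "2 * (k + 2 * l) \<le> \<theta>" "exp (\<theta> * \<delta>) \<le> 2"
    and lip: "\<And>t x x' y y'. t \<in> {s..T} \<Longrightarrow>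
        norm (F t x y - F t x' y') \<le> k * norm (x - x') + l * norm (y - y')"
    and X: "continuous_on {s..T} X"
      "\<And>t. t \<in> {s..T} \<Longrightarrow> ((\<lambda>r. F r (X r) (delayed s \<delta> J X r)) has_integral (X t - M)) {t..T}"
    and Y: "continuous_on {s..T} Y"
      "\<And>t. t \<in> {s..T} \<Longrightarrow> ((\<lambda>r. F r (Y r) (delayed s \<delta> J Y r)) has_integral (Y t - M)) {t..T}"
    and t: "t \<in> {s..T}"
  shows "X t = Y t"
proof -
  have "norm (X t - Y t) \<le> 2 * (0 + (T - s) * (0 + l * 0)) * exp (\<theta> * (T - s))"
  proof (rule delayed_integral_inequality[OF sT \<delta> nonneg _ _ _ \<theta> _ _ _ t])
    show "continuous_on {s..T} (\<lambda>t. norm (X t - Y t))" by (intro continuous_intros X Y)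
  next
    fix t \<phi> I assume t: "t \<in> {s..T}" and \<phi>: "(\<phi> has_integral I) {t..T}"
      and le: "\<And>r. r \<in> {t..T} \<Longrightarrow>
        k * norm (X r - Y r) + l * delayed s \<delta> 0 (\<lambda>t. norm (X t - Y t)) r + 0 \<le> \<phi> r"
    define D where "D r = F r (X r) (delayed s \<delta> J X r) - F r (Y r) (delayed s \<delta> J Y r)" for r
    have D: "(D has_integral (X t - Y t)) {t..T}"
      using has_integral_diff[OF X(2)[OF t] Y(2)[OF t]] by (simp add: D_def[abs_def])
    have "norm (D r) \<le> \<phi> r" if "r \<in> {t..T}" for r
    proof -
      have "norm (D r) \<le> k * norm (X r - Y r) + l * norm (delayed s \<delta> J X r - delayed s \<delta> J Y r)"
        unfolding D_def by (rule lip) (use that t in auto)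
      also have "norm (delayed s \<delta> J X r - delayed s \<delta> J Y r) = delayed s \<delta> 0 (\<lambda>t. norm (X t - Y t)) r"
        by (simp add: delayed_def)
      finally show ?thesis using le[OF that] by simp
    qed
    then have "norm (integral {t..T} D) \<le> integral {t..T} \<phi>"
      using D \<phi> by (intro integral_norm_bound_integral) (auto simp: integrable_on_def)
    then show "norm (X t - Y t) \<le> 0 + I" using D \<phi> by (simp add: integral_unique)
  qed auto
  then show ?thesis by simp
qed

lemma quadratic_increments_imp_constant:
  fixes g :: "real \<Rightarrow> 'a::real_normed_vector"
  assumes incr: "\<And>r t. a \<le> r \<Longrightarrow> r \<le> t \<Longrightarrow> t \<le> b \<Longrightarrow> norm (g t - g r) \<le> C * (t - r)\<^sup>2"
    and t: "t \<in> {a..b}"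
  shows "g t = g a"
proof -
  have sym: "norm (g y - g x) \<le> C * (y - x)\<^sup>2" if "x \<in> {a..b}" "y \<in> {a..b}" for x y
    using incr[of x y] incr[of y x] that by (cases "x \<le> y") (auto simp: norm_minus_commute power2_commute)
  have "(g has_derivative (\<lambda>_. 0)) (at x within {a..b})" if x: "x \<in> {a..b}" for x
    unfolding has_derivative_within_alt
  proof (intro conjI allI impI bounded_linear_zero)
    fix e :: real assume "e > 0"
    show "\<exists>d>0. \<forall>y\<in>{a..b}. norm (y - x) < d \<longrightarrow> norm (g y - g x - 0) \<le> e * norm (y - x)"
    \<comment> \<open>\<open>\<bar>C\<bar> + 1\<close> rather than C, because C may be zero or
      negative.\<close>
    proof (intro exI[of _ "e / (\<bar>C\<bar> + 1)"] conjI ballI impI)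
      fix y assume y: "y \<in> {a..b}" "norm (y - x) < e / (\<bar>C\<bar> + 1)"
      have "norm (g y - g x) \<le> C * (y - x)\<^sup>2" by (rule sym[OF x y(1)])
      also have "\<dots> \<le> (\<bar>C\<bar> + 1) * (y - x)\<^sup>2" by (intro mult_right_mono) auto
      also have "\<dots> = ((\<bar>C\<bar> + 1) * \<bar>y - x\<bar>) * \<bar>y - x\<bar>" by (simp add: power2_eq_square flip: abs_mult)
      also have "\<dots> \<le> e * \<bar>y - x\<bar>"
        using y(2) by (intro mult_right_mono) (auto simp: field_simps)
      finally show "norm (g y - g x - 0) \<le> e * norm (y - x)" by simp
    qed (use \<open>e > 0\<close> in auto)
  qed
  then obtain c where "\<And>x. x \<in> {a..b} \<Longrightarrow> g x = c"
    using has_derivative_zero_constant[of "{a..b}" g] by auto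
  then show ?thesis using t by auto
qed

section \<open>Caratheodory solutions: restriction, time reversal, inversion\<close>

lemma ode_solution_on_cong:
  "ode_solution_on a b X F \<Longrightarrow> (\<And>t. t \<in> {a..b} \<Longrightarrow> F t = F' t) \<Longrightarrow> ode_solution_on a b X F'"
  unfolding ode_solution_on_def by (auto intro: has_integral_eq[rotated])

lemma ode_solution_on_increment:
  assumes sol: "ode_solution_on a b X F" and "a \<le> r" "r \<le> t" "t \<le> b"
  shows "(F has_integral (X t - X r)) {r..t}"
proof -
  have *: "(F has_integral (X t - X a)) {a..t}" "(F has_integral (X r - X a)) {a..r}"
    using assms by (auto simp: ode_solution_on_def)
  then have "F integrable_on {r..t}"
    using assms by (auto intro: integrable_on_subinterval)
  then have "(F has_integral integral {r..t} F) {r..t}" by (rule integrable_integral)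
  moreover from has_integral_combine[OF \<open>a \<le> r\<close> \<open>r \<le> t\<close> *(2) this]
  have "(X r - X a) + integral {r..t} F = X t - X a"
    using *(1) has_integral_unique by blast
  then have "integral {r..t} F = X t - X r" by (simp add: algebra_simps)
  ultimately show ?thesis by simp
qed

text \<open>The value is prescribed at b, so the fixed point arguments integrate over [t,b], whereas
  the definition integrates from a.\<close>

lemma ode_solution_on_backward:
  assumes "a \<le> b"
  shows "ode_solution_on a b X F \<longleftrightarrow>
    continuous_on {a..b} X \<and> (\<forall>t\<in>{a..b}. ((\<lambda>r. - F r) has_integral (X t - X b)) {t..b})"
proof
  assume sol: "ode_solution_on a b X F"
  show "continuous_on {a..b} X \<and> (\<forall>t\<in>{a..b}. ((\<lambda>r. - F r) has_integral (X t - X b)) {t..b})"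
    using has_integral_neg[OF ode_solution_on_increment[OF sol, of _ b]] sol
    by (auto simp: ode_solution_on_def)
next
  assume r: "continuous_on {a..b} X \<and> (\<forall>t\<in>{a..b}. ((\<lambda>r. - F r) has_integral (X t - X b)) {t..b})"
  show "ode_solution_on a b X F"
    unfolding ode_solution_on_def
  proof (intro conjI ballI)
    fix t assume t: "t \<in> {a..b}"
    have *: "(F has_integral (X b - X t)) {t..b}" "(F has_integral (X b - X a)) {a..b}"
      using r t assms has_integral_neg[of "\<lambda>r. - F r" "X t - X b" "{t..b}"]
        has_integral_neg[of "\<lambda>r. - F r" "X a - X b" "{a..b}"] by auto
    then have "F integrable_on {a..t}"
      using t by (auto intro: integrable_on_subinterval)
    then have "(F has_integral integral {a..t} F) {a..t}" by (rule integrable_integral)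
    moreover from has_integral_combine[OF _ _ this *(1)] t
    have "integral {a..t} F + (X b - X t) = X b - X a"
      using *(2) has_integral_unique by (metis atLeastAtMost_iff)
    then have "integral {a..t} F = X t - X a" by (simp add: algebra_simps)
    ultimately show "(F has_integral (X t - X a)) {a..t}" by simp
  qed (use r in blast)
qed

text \<open>The coefficients are only measurable, so the derivative of the inverse cannot be taken
  pointwise; instead the defect of the claimed identity has increments of second order.\<close>

lemma ode_solution_on_matrix_inv:
  fixes X :: "real \<Rightarrow> real^'n^'n"
  assumes sol: "ode_solution_on a b X F" and inv: "\<And>t. t \<in> {a..b} \<Longrightarrow> invertible (X t)"
    and F: "bounded_measurable {a..b} F"
  shows "ode_solution_on a b (\<lambda>t. matrix_inv (X t)) (\<lambda>t. - (matrix_inv (X t) ** F t ** matrix_inv (X t)))"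
proof -
  define Y where "Y t = matrix_inv (X t)" for t
  define f where "f t = Y t ** F t ** Y t" for t
  have X: "continuous_on {a..b} X" using sol by (simp add: ode_solution_on_def)
  have Y: "continuous_on {a..b} Y"
    unfolding Y_def by (intro continuous_on_matrix_inv X inv)
  have f_bm: "bounded_measurable {a..b} f"
    unfolding f_def by (intro bounded_measurable_intros F bounded_measurable_continuous Y)
  have f_int: "f integrable_on {r..t}" if "a \<le> r" "t \<le> b" for r t
    by (rule bounded_measurable_integrable[OF f_bm]) (use that in auto)
  obtain C where C: "C > 0" "\<And>t. t \<in> {a..b} \<Longrightarrow> norm (F t) \<le> C"
    using F by (auto simp: bounded_measurable_def bounded_pos)
  have "bounded (Y ` {a..b})" using Y by (simp add: compact_continuous_image compact_imp_bounded)
  then obtain D where D: "D > 0" "\<And>t. t \<in> {a..b} \<Longrightarrow> norm (Y t) \<le> D"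
    by (auto simp: bounded_pos)
  \<comment> \<open>The resolvent identity; it makes Y Lipschitz and gives the increment of Y with
    one factor frozen at each endpoint.\<close>
  have Y_diff: "Y t - Y r = - (Y t ** (X t - X r) ** Y r)" if "r \<in> {a..b}" "t \<in> {a..b}" for r t
    using that matrix_inv_left_inverse[OF inv[OF that(2)]] matrix_inv_right_inverse[OF inv[OF that(1)]]
    by (simp add: Y_def matrix_mult_simps) (simp flip: matrix_mul_assoc)
  have Y_lip: "norm (Y t - Y r) \<le> D * (C * (t - r)) * D" if "a \<le> r" "r \<le> t" "t \<le> b" for r t
  proof -
    have h: "norm (X t - X r) \<le> C * (t - r)"
      using has_integral_bound_real[OF _ finite.emptyI ode_solution_on_increment[OF sol that], of C] C that by auto
    have "norm (Y t ** (X t - X r) ** Y r) \<le> D * (C * (t - r)) * D"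
      by (rule norm_matrix_mult3_le[OF D(2) h D(2)]) (use that in auto)
    then show ?thesis using that by (subst Y_diff) auto
  qed
  \<comment> \<open>The defect of the claimed equation: g constant is exactly the integrated form of
    Y' = -Y F Y.\<close>
  define g where "g t = Y t + integral {a..t} f" for t
  have "g t = g a" if t: "t \<in> {a..b}" for t
  proof (rule quadratic_increments_imp_constant[of a b g "2 * D^3 * C^2", OF _ t])
    fix r t assume rt: "a \<le> r" "r \<le> t" "t \<le> b"
    have "integral {a..r} f + integral {r..t} f = integral {a..t} f"
      by (rule Henstock_Kurzweil_Integration.integral_combine) (use rt f_int in auto)
    then have eq: "g t - g r = integral {r..t} f - Y t ** (X t - X r) ** Y r"
      using Y_diff[of r t] rt by (auto simp: g_def algebra_simps)
    have "((\<lambda>u. Y t ** F u ** Y r) has_integral (Y t ** (X t - X r) ** Y r)) {r..t}"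
      using has_integral_linear[OF ode_solution_on_increment[OF sol rt],
          of "\<lambda>Z. Y t ** Z ** Y r"]
        bounded_linear_compose[OF bounded_bilinear.bounded_linear_left[OF bounded_bilinear_matrix_mult, of "Y r"]
          bounded_bilinear.bounded_linear_right[OF bounded_bilinear_matrix_mult, of "Y t"]]
      by (simp add: o_def)
    moreover have "(f has_integral integral {r..t} f) {r..t}"
      using f_int rt by (simp add: integrable_integral)
    ultimately have "((\<lambda>u. f u - Y t ** F u ** Y r) has_integral (g t - g r)) {r..t}"
      unfolding eq by (intro has_integral_diff)
    moreover have "norm (f u - Y t ** F u ** Y r) \<le> 2 * D^3 * C^2 * (t - r)" if u: "u \<in> {r..t}" for u
    proof -
      \<comment> \<open>Replacing Y u by an endpoint value costs the Lipschitz bound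
        \<open>D * (C * (t - r)) * D\<close>. Doing so on both sides, with the other factors bounded
        by C and D, gives the constant \<open>2 * D^3 * C^2\<close>.\<close>
      have "f u - Y t ** F u ** Y r = - ((Y t - Y u) ** F u ** Y u) + Y t ** F u ** (Y u - Y r)"
        by (simp add: f_def matrix_mult_simps)
      also have "norm \<dots> \<le> norm ((Y t - Y u) ** F u ** Y u) + norm (Y t ** F u ** (Y u - Y r))"
        by (rule order_trans[OF norm_triangle_ineq]) simp
      also have "\<dots> \<le> (D * (C * (t - r)) * D) * C * D + D * C * (D * (C * (t - r)) * D)"
      proof (intro add_mono norm_matrix_mult3_le)
        have "D * (C * (t - u)) * D \<le> D * (C * (t - r)) * D" "D * (C * (u - r)) * D \<le> D * (C * (t - r)) * D"
          using u C D by (auto intro!: mult_left_mono mult_right_mono)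
        then show "norm (Y t - Y u) \<le> D * (C * (t - r)) * D" "norm (Y u - Y r) \<le> D * (C * (t - r)) * D"
          using Y_lip[of u t] Y_lip[of r u] u rt by auto
      qed (use u rt C D in auto)
      finally show ?thesis by (simp add: power2_eq_square power3_eq_cube algebra_simps)
    qed
    ultimately have "norm (g t - g r) \<le> 2 * D^3 * C^2 * (t - r) * (t - r)"
      using has_integral_bound_real[of "2 * D^3 * C^2 * (t - r)" "{}" _ "g t - g r" r t] rt C D by auto
    then show "norm (g t - g r) \<le> 2 * D^3 * C^2 * (t - r)\<^sup>2"
      by (simp add: power2_eq_square mult.assoc)
  qed
  then have "Y t - Y a = - integral {a..t} f" if "t \<in> {a..b}" for t
    using that by (fastforce simp: g_def algebra_simps)
  then have "((\<lambda>t. - f t) has_integral (Y t - Y a)) {a..t}" if "t \<in> {a..b}" for t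
    using that has_integral_neg[OF integrable_integral[OF f_int[of a t]]] by auto
  then have "ode_solution_on a b Y (\<lambda>t. - f t)"
    using Y by (simp add: ode_solution_on_def)
  then show ?thesis by (simp add: Y_def[abs_def] f_def[abs_def])
qed

section \<open>Null sets, translations and cut-offs of coefficients\<close>

lemma ode_solution_on_negligible_cong:
  assumes "negligible N" "\<And>t. t \<in> {a..b} - N \<Longrightarrow> F t = F' t"
  shows "ode_solution_on a b X F \<longleftrightarrow> ode_solution_on a b X F'"
proof -
  have "(F has_integral I) {a..t} \<longleftrightarrow> (F' has_integral I) {a..t}" if "t \<in> {a..b}" for I t
    by (rule has_integral_spike_eq[OF assms(1)]) (use assms(2) that in auto)
  then show ?thesis unfolding ode_solution_on_def by blast
qed

lemma AE_lebesgue_on_negligible: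
  assumes "AE t in lebesgue_on {a..b::real}. P t"
  obtains N where "negligible N" "\<And>t. t \<in> {a..b} - N \<Longrightarrow> P t"
proof -
  have "AE t in lebesgue. t \<in> {a..b} \<longrightarrow> P t"
    using assms by (subst (asm) AE_restrict_space_iff) auto
  then show ?thesis
    by (rule AE_E3) (use that in \<open>auto simp: negligible_iff_null_sets\<close>)
qed

text \<open>Measurability is transported through integrability: integrals translate, and an
  integrable function is measurable.\<close>

lemma bounded_measurable_shift:
  fixes f :: "real \<Rightarrow> 'a::euclidean_space"
  assumes f: "bounded_measurable {a..b} f"
  shows "bounded_measurable {a - c..b - c} (\<lambda>t. f (t + c))"
  unfolding bounded_measurable_def
proof
  have "(\<lambda>t. f (t + c)) integrable_on {a - c..b - c}"
    using bounded_measurable_integrable[OF f order_refl] by (rule integrable_shift_real_ivl)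
  then show "(\<lambda>t. f (t + c)) \<in> borel_measurable (lebesgue_on {a - c..b - c})"
    by (rule integrable_imp_measurable)
  have "bounded (f ` {a..b})" using f by (simp add: bounded_measurable_def)
  then show "bounded ((\<lambda>t. f (t + c)) ` {a - c..b - c})"
    by (rule bounded_subset) (auto intro!: imageI)
qed

lemma bounded_measurable_cong:
  assumes f: "bounded_measurable S f" and eq: "\<And>t. t \<in> S \<Longrightarrow> f t = g t"
  shows "bounded_measurable S g"
proof -
  have "f \<in> borel_measurable (lebesgue_on S) \<longleftrightarrow> g \<in> borel_measurable (lebesgue_on S)"
    by (rule measurable_cong) (simp add: eq)
  moreover have "f ` S = g ` S" by (rule image_cong) (simp_all add: eq)
  ultimately show ?thesis using f by (simp add: bounded_measurable_def)
qed

text \<open>Meant for maps such as \<open>matrix_inv\<close> that are continuous and bounded only on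
  a closed set of good arguments. Extension by zero is Borel, which suffices for composition with a
  measurable coefficient.\<close>

lemma bounded_measurable_restrict_closed:
  fixes f :: "real \<Rightarrow> 'a::euclidean_space" and h :: "'a \<Rightarrow> 'b::euclidean_space"
  assumes f: "f \<in> borel_measurable (lebesgue_on S)" and U: "closed U" and h: "continuous_on U h"
    and bound: "\<And>x. x \<in> U \<Longrightarrow> norm (h x) \<le> c" and "c \<ge> 0"
  shows "bounded_measurable S (\<lambda>t. if f t \<in> U then h (f t) else 0)"
  unfolding bounded_measurable_def
proof
  have "(\<lambda>x. if x \<in> U then h x else 0) \<in> borel_measurable borel"
    by (intro borel_measurable_continuous_on_if h continuous_intros borel_closed U)
  from measurable_compose[OF f this]
  show "(\<lambda>t. if f t \<in> U then h (f t) else 0) \<in> borel_measurable (lebesgue_on S)" .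
  show "bounded ((\<lambda>t. if f t \<in> U then h (f t) else 0) ` S)"
    using bound \<open>c \<ge> 0\<close> by (auto simp: bounded_iff intro!: exI[of _ c])
qed

section \<open>Invariance of the positive cone\<close>

text \<open>Pairs of a time and a unit vector on which the form is nonpositive form a compact set.
  Its pair with the largest time is the first exit seen from T, and the isotropic vector there lies
  in the kernel.\<close>

lemma first_exit_from_pd:
  fixes Y :: "real \<Rightarrow> real^'n^'n"
  assumes Y: "continuous_on {s..T} Y" "\<And>t. t \<in> {s..T} \<Longrightarrow> Y t \<in> sym_mats" "Y T \<in> pd_mats"
    and t1: "t1 \<in> {s..T}" "Y t1 \<notin> pd_mats"
  obtains t0 v where "t0 \<in> {s..<T}" "v \<noteq> 0" "Y t0 *v v = 0"
    "\<And>t. t \<in> {t0..T} \<Longrightarrow> Y t \<in> psd_mats"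
proof -
  define f where "f p = snd p \<bullet> (Y (fst p) *v snd p)" for p
  define S where "S = {s..T} \<times> sphere (0 :: real^'n) 1"
  define Z where "Z = S \<inter> f -` {..0}"
  have "compact S" unfolding S_def by (intro compact_Times) auto
  have "continuous_on S (\<lambda>p. Y (fst p))"
    by (rule continuous_on_compose2[OF Y(1)]) (auto simp: S_def intro!: continuous_intros)
  then have f: "continuous_on S f"
    unfolding f_def by (intro continuous_intros)
  have "closed Z"
    unfolding Z_def by (rule continuous_closed_preimage[OF f]) (use \<open>compact S\<close> in \<open>auto simp: compact_imp_closed\<close>)
  then have "compact Z"
    using \<open>compact S\<close> compact_Int_closed[of S Z] by (simp add: Z_def Int_absorb1 Int_assoc[symmetric])
  have in_Z: "(t, w /\<^sub>R norm w) \<in> Z" if "t \<in> {s..T}" "w \<noteq> 0" "w \<bullet> (Y t *v w) \<le> 0" for t w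
    using that by (auto simp: Z_def S_def f_def matrix_vector_simps mult_nonneg_nonpos)
  obtain w where "w \<noteq> 0" "w \<bullet> (Y t1 *v w) \<le> 0"
    using t1 Y(2)[OF t1(1)] by (auto simp: pd_mats_def pos_form_def not_less)
  then have "Z \<noteq> {}" using in_Z[OF t1(1)] by auto
  with \<open>compact Z\<close> obtain p where p: "p \<in> Z" "\<And>p'. p' \<in> Z \<Longrightarrow> fst p' \<le> fst p"
    using continuous_attains_sup[of Z fst] continuous_on_fst[OF continuous_on_id] by blast
  obtain t0 v where tv: "p = (t0, v)" by (cases p)
  have t0: "t0 \<in> {s..T}" and v: "norm v = 1" "v \<bullet> (Y t0 *v v) \<le> 0"
    using p(1) by (auto simp: tv Z_def S_def f_def)
  have "v \<noteq> 0" using v by auto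
  have pos: "0 < w \<bullet> (Y t *v w)" if "t \<in> {t0<..T}" "w \<noteq> 0" for t w
    using in_Z[of t w] p(2) that t0 by (force simp: tv)
  have "t0 \<noteq> T" using \<open>v \<noteq> 0\<close> v(2) Y(3) by (auto simp: pd_mats_def pos_form_def not_less[symmetric])
  then have "t0 < T" using t0 by simp
  \<comment> \<open>After t0 the form is strictly positive; passing to the closure covers t0 itself,
    as needed to turn the isotropic vector into a kernel vector.\<close>
  have "0 \<le> w \<bullet> (Y t *v w)" if t: "t \<in> {t0..T}" for t w
  proof (rule continuous_ge_on_closure[where f = "\<lambda>t. w \<bullet> (Y t *v w)" and S = "{t0<..T}"])
    have "continuous_on {t0..T} Y" by (rule continuous_on_subset[OF Y(1)]) (use t0 in auto)
    then show "continuous_on (closure {t0<..T}) (\<lambda>t. w \<bullet> (Y t *v w))"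
      using \<open>t0 < T\<close> by (auto intro!: continuous_intros)
    show "t \<in> closure {t0<..T}" using t \<open>t0 < T\<close> by simp
    show "0 \<le> w \<bullet> (Y t *v w)" if "t \<in> {t0<..T}" for t
      using pos[OF that, of w] by (cases "w = 0") (auto simp: matrix_vector_simps)
  qed
  then have psd: "Y t \<in> psd_mats" if "t \<in> {t0..T}" for t
    using Y(2)[of t] that t0 by (simp add: psd_mats_def)
  show ?thesis
  proof (rule that)
    show "Y t0 *v v = 0" by (rule psd_isotropic_imp_kernel[OF psd v(2)]) (use t0 in auto)
  qed (use t0 \<open>t0 \<noteq> T\<close> \<open>v \<noteq> 0\<close> psd in auto)
qed

text \<open>At the first exit of \<open>X t - \<mu> t *\<^sub>R mat 1\<close> from the cone, with \<open>\<mu>\<close> decaying faster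
  than the flow allows, the kernel vector \<open>v\<close> is almost an eigenvector of \<open>X\<close> shortly
  afterwards, which contradicts the growth bound.\<close>

lemma pd_backward:
  fixes X :: "real \<Rightarrow> real^'n^'n"
  assumes sol: "ode_solution_on s T X F"
    and sym: "\<And>t. t \<in> {s..T} \<Longrightarrow> X t \<in> sym_mats" and XT: "X T \<in> pd_mats" and \<kappa>: "\<kappa> \<ge> 0"
    and growth: "\<And>r v. r \<in> {s..T} \<Longrightarrow> X r \<in> psd_mats \<Longrightarrow>
        v \<bullet> (F r *v v) \<le> \<kappa> * norm v * norm (X r *v v)"
    and t: "t \<in> {s..T}"
  shows "X t \<in> pd_mats"
proof -
  obtain \<beta> where \<beta>: "\<beta> > 0" "\<And>v. \<beta> * (v \<bullet> v) \<le> v \<bullet> (X T *v v)"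
    using pd_imp_coercive[OF XT] by blast
  \<comment> \<open>The rate \<kappa> + 1 beats the permitted \<kappa>, and the factor \<beta> / 2
    leaves Y positive definite at T.\<close>
  define \<mu> where "\<mu> r = \<beta> / 2 * exp ((\<kappa> + 1) * (r - T))" for r
  have \<mu>_pos: "\<mu> r > 0" for r using \<beta> by (simp add: \<mu>_def)
  define Y where "Y r = X r - \<mu> r *\<^sub>R mat 1" for r
  have quad: "v \<bullet> (X r *v v) = v \<bullet> (Y r *v v) + \<mu> r * (v \<bullet> v)" for v r
    by (simp add: Y_def matrix_vector_simps inner_simps)
  have contX: "continuous_on {s..T} X" using sol by (simp add: ode_solution_on_def)
  have Y_sym: "Y r \<in> sym_mats" if "r \<in> {s..T}" for r
    using sym[OF that] by (simp add: Y_def sym_mats_def transpose_simps)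
  have "Y t \<in> pd_mats"
  proof (rule ccontr)
    assume "Y t \<notin> pd_mats"
    have "Y T \<in> pd_mats"
    proof -
      have "0 < v \<bullet> (Y T *v v)" if "v \<noteq> 0" for v
      proof -
        have "0 < v \<bullet> v" using that by simp
        moreover have "v \<bullet> (Y T *v v) \<ge> \<beta> * (v \<bullet> v) - \<beta> / 2 * (v \<bullet> v)"
          using quad[of v T] \<beta>(2)[of v] by (simp add: \<mu>_def)
        ultimately show ?thesis using \<beta>(1) by (smt (verit) field_sum_of_halves mult_pos_pos distrib_right)
      qed
      then show ?thesis using Y_sym[of T] t by (simp add: pd_mats_def pos_form_def)
    qed
    moreover have "continuous_on {s..T} Y"
      unfolding Y_def \<mu>_def by (intro continuous_intros contX)
    ultimately obtain t0 v where t0: "t0 \<in> {s..<T}" and v: "v \<noteq> 0" "Y t0 *v v = 0"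
      and Y_psd: "\<And>t. t \<in> {t0..T} \<Longrightarrow> Y t \<in> psd_mats"
      using first_exit_from_pd[of s T Y t] Y_sym t \<open>Y t \<notin> pd_mats\<close> by metis
    have X_psd: "X r \<in> psd_mats" if "r \<in> {t0..T}" for r
    proof -
      have "X r = Y r + \<mu> r *\<^sub>R mat 1" by (simp add: Y_def)
      then show ?thesis
        using psd_add[OF Y_psd[OF that] psd_scaleR[OF psd_mat_1, of "\<mu> r"]] \<mu>_pos[of r] by simp
    qed
    \<comment> \<open>Chosen so that \<kappa> * (\<mu> t0 + \<epsilon>) is still strictly below
      (\<kappa> + 1) * \<mu> t0; the gap is what yields the contradiction.\<close>
    define \<epsilon> where "\<epsilon> = \<mu> t0 / (\<kappa> + 1)"
    have "\<epsilon> * norm v > 0" using \<mu>_pos \<kappa> v by (simp add: \<epsilon>_def)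
    moreover have "continuous_on {s..T} (\<lambda>r. X r *v v)" by (intro continuous_intros contX)
    ultimately obtain d where d: "d > 0" "\<And>r. r \<in> {s..T} \<Longrightarrow> dist r t0 < d \<Longrightarrow>
        dist (X r *v v) (X t0 *v v) < \<epsilon> * norm v"
      using t0 unfolding continuous_on_iff by (metis atLeastLessThan_iff atLeastAtMost_iff less_imp_le)
    define h where "h = min (d / 2) (T - t0)"
    have h: "h > 0" "h < d" "t0 + h \<le> T" using d t0 by (auto simp: h_def)
    have Xt0: "X t0 *v v = \<mu> t0 *\<^sub>R v"
      using v(2) by (simp add: Y_def matrix_vector_simps)
    \<comment> \<open>The vector v stays fixed while time moves: the form on v can be integrated
      over a short interval although F is merely measurable.\<close>
    have "((\<lambda>r. v \<bullet> (F r *v v)) has_integral v \<bullet> ((X (t0 + h) - X t0) *v v)) {t0..t0 + h}"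
      using has_integral_linear[OF ode_solution_on_increment[OF sol, of t0 "t0 + h"],
          of "\<lambda>Z. v \<bullet> (Z *v v)"] t0 h
        bounded_linear_compose[OF bounded_linear_inner_right[of v]
          bounded_bilinear.bounded_linear_left[OF bounded_bilinear_matrix_vector_mult, of v]]
      by (simp add: o_def)
    moreover have "((\<lambda>r. \<kappa> * norm v * ((\<mu> t0 + \<epsilon>) * norm v)) has_integral
        h * (\<kappa> * norm v * ((\<mu> t0 + \<epsilon>) * norm v))) {t0..t0 + h}"
      using has_integral_const_real[of "\<kappa> * norm v * ((\<mu> t0 + \<epsilon>) * norm v)" t0 "t0 + h"] h by simp
    moreover have "v \<bullet> (F r *v v) \<le> \<kappa> * norm v * ((\<mu> t0 + \<epsilon>) * norm v)" if r: "r \<in> {t0..t0 + h}" for r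
    proof -
      have "norm (X r *v v) \<le> norm (X t0 *v v) + norm (X r *v v - X t0 *v v)"
        by (metis add.commute diff_add_cancel norm_triangle_ineq)
      also have "\<dots> \<le> \<mu> t0 * norm v + \<epsilon> * norm v"
        using d(2)[of r] r h t0 \<mu>_pos[of t0] by (simp add: Xt0 dist_norm)
      finally have "norm (X r *v v) \<le> (\<mu> t0 + \<epsilon>) * norm v" by (simp add: distrib_right)
      then have "\<kappa> * norm v * norm (X r *v v) \<le> \<kappa> * norm v * ((\<mu> t0 + \<epsilon>) * norm v)"
        using \<kappa> by (intro mult_left_mono) auto
      then show ?thesis using growth[of r v] X_psd[of r] r h t0 by force
    qed
    ultimately have "v \<bullet> ((X (t0 + h) - X t0) *v v) \<le> h * (\<kappa> * norm v * ((\<mu> t0 + \<epsilon>) * norm v))"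
      by (rule has_integral_le)
    also have "\<dots> = (h * \<kappa> * (\<mu> t0 + \<epsilon>)) * (v \<bullet> v)"
      by (simp add: dot_square_norm power2_eq_square)
    finally have upper: "v \<bullet> ((X (t0 + h) - X t0) *v v) \<le> (h * \<kappa> * (\<mu> t0 + \<epsilon>)) * (v \<bullet> v)" .
    \<comment> \<open>Opposite bound for the same increment: Y is still in the cone at t0 + h and
      vanishes on v at t0, so v \<bullet> (X v) must grow at least as much as \<mu> * (v \<bullet>
      v).\<close>
    have "\<mu> (t0 + h) = \<mu> t0 * exp ((\<kappa> + 1) * h)"
      by (simp add: \<mu>_def algebra_simps flip: exp_add)
    also have "\<dots> \<ge> \<mu> t0 * (1 + (\<kappa> + 1) * h)"
      using \<mu>_pos[of t0] by (intro mult_left_mono exp_ge_add_one_self) simp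
    finally have "\<mu> t0 * (\<kappa> + 1) * h * (v \<bullet> v) \<le> (\<mu> (t0 + h) - \<mu> t0) * (v \<bullet> v)"
      by (intro mult_right_mono) (auto simp: algebra_simps)
    also have "\<dots> \<le> v \<bullet> ((X (t0 + h) - X t0) *v v)"
    proof -
      have "0 \<le> v \<bullet> (Y (t0 + h) *v v)" using Y_psd[of "t0 + h"] h by (simp add: psd_mats_def)
      then show ?thesis
        using quad[of v "t0 + h"] by (simp add: matrix_vector_simps inner_simps Xt0 algebra_simps)
    qed
    also note upper
    finally have "\<mu> t0 * (\<kappa> + 1) * h \<le> h * \<kappa> * (\<mu> t0 + \<epsilon>)"
      by (rule mult_right_le_imp_le) (use v(1) in simp)
    then have "\<mu> t0 * (\<kappa> + 1) \<le> \<kappa> * (\<mu> t0 + \<epsilon>)" using h(1) by (simp add: mult.commute mult.left_commute)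
    also have "\<kappa> * (\<mu> t0 + \<epsilon>) = \<mu> t0 * (\<kappa> + \<kappa> / (\<kappa> + 1))"
      by (simp add: \<epsilon>_def algebra_simps)
    finally have "\<kappa> + 1 \<le> \<kappa> + \<kappa> / (\<kappa> + 1)" using \<mu>_pos[of t0] by simp
    then show False using \<kappa> by (simp add: field_simps)
  qed
  then show ?thesis
    using quad[of _ t] \<mu>_pos[of t] sym[OF t]
    by (auto simp: pd_mats_def pos_form_def intro!: add_pos_nonneg mult_nonneg_nonneg less_imp_le[OF \<mu>_pos])
qed

text \<open>The projection onto a centred ball only rescales. Hence truncating a matrix preserves
  symmetry and kernel vectors, and never enlarges its action on a vector.\<close>

lemma closest_point_cball_radial:
  fixes x :: "'a::euclidean_space"
  assumes "R \<ge> 0"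
  obtains \<rho> where "0 \<le> \<rho>" "\<rho> \<le> 1" "closest_point (cball 0 R) x = \<rho> *\<^sub>R x"
proof (cases "norm x \<le> R")
  case True
  then show ?thesis using that[of 1] by (simp add: closest_point_self)
next
  case False
  then have pos: "norm x > 0" using assms by linarith
  have "closest_point (cball 0 R) x = (R / norm x) *\<^sub>R x"
  proof (rule closest_point_unique[symmetric])
    show "(R / norm x) *\<^sub>R x \<in> cball 0 R" using assms pos by simp
    show "\<forall>z\<in>cball 0 R. dist x ((R / norm x) *\<^sub>R x) \<le> dist x z"
    proof
      fix z :: 'a assume "z \<in> cball 0 R"
      have "x - (R / norm x) *\<^sub>R x = (1 - R / norm x) *\<^sub>R x" by (simp add: scaleR_diff_left)
      then have "dist x ((R / norm x) *\<^sub>R x) = \<bar>1 - R / norm x\<bar> * norm x"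
        by (simp only: dist_norm norm_scaleR)
      also have "\<dots> = norm x - R"
        using False assms pos by (simp add: abs_if field_simps)
      also have "\<dots> \<le> norm x - norm z" using \<open>z \<in> cball 0 R\<close> by simp
      also have "\<dots> \<le> dist x z" by (simp add: dist_norm norm_triangle_ineq2)
      finally show "dist x ((R / norm x) *\<^sub>R x) \<le> dist x z" .
    qed
  qed auto
  then show ?thesis using that[of "R / norm x"] False assms pos by simp
qed

section \<open>The equation for the inverse\<close>

text \<open>The fixed point is sought among all matrices. Symmetrising the argument gives the
  truncated right-hand side symmetric values everywhere, so symmetry of the solution is a
  conclusion.\<close>

definition sym_part :: "real^'n^'n \<Rightarrow> real^'n^'n" where
  "sym_part X = (1 / 2) *\<^sub>R (X + transpose X)"

lemma sym_part_diff: "sym_part X - sym_part Y = sym_part (X - Y)"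
  by (simp add: sym_part_def transpose_simps algebra_simps)

lemma norm_sym_part_le: "norm (sym_part X) \<le> norm X"
  using norm_triangle_ineq[of X "transpose X"] by (simp add: sym_part_def)

lemma sym_part_in_sym_mats: "sym_part X \<in> sym_mats"
  by (simp add: sym_part_def sym_mats_def transpose_simps add.commute)

lemma sym_part_ident: "X \<in> sym_mats \<Longrightarrow> sym_part X = X"
  by (simp add: sym_part_def sym_mats_def scaleR_2[symmetric])

lemma continuous_on_sym_part [continuous_intros]:
  "continuous_on S f \<Longrightarrow> continuous_on S (\<lambda>x. sym_part (f x))"
  unfolding sym_part_def by (intro continuous_intros)

lemma closest_point_cball_sym:
  assumes "X \<in> sym_mats" "R \<ge> 0" shows "closest_point (cball 0 R) X \<in> sym_mats"
proof -
  obtain \<rho> where "closest_point (cball 0 R) X = \<rho> *\<^sub>R X"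
    using closest_point_cball_radial[OF assms(2)] by blast
  then show ?thesis using assms(1) by (simp add: sym_mats_def transpose_simps)
qed

lemma closest_point_psd: "closest_point psd_mats Z \<in> psd_mats"
  using closest_point_in_set[OF closed_psd] psd_zero by auto

lemma sym_mats_intros:
  "X \<in> sym_mats \<Longrightarrow> Y \<in> sym_mats \<Longrightarrow> X + Y \<in> sym_mats"
  "X \<in> sym_mats \<Longrightarrow> Y \<in> sym_mats \<Longrightarrow> X - Y \<in> sym_mats"
  "X \<in> sym_mats \<Longrightarrow> c *\<^sub>R X \<in> sym_mats"
  "X \<in> sym_mats \<Longrightarrow> A ** X ** transpose A \<in> sym_mats"
  "X \<in> sym_mats \<Longrightarrow> Y \<in> sym_mats \<Longrightarrow> X ** Y ** X \<in> sym_mats"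
  by (simp_all add: sym_mats_def transpose_simps matrix_mul_assoc)

text \<open>Here q is the sum of the Q weights and G the sum of the two terms with an inverse of
  \<open>calN\<close>. One constant L bounds all coefficients and M, and the sign conditions hold at
  every time.\<close>

locale sigma_equation =
  fixes s T \<delta> L :: real and A B Bb q G :: "real \<Rightarrow> real^'n^'n" and M :: "real^'n^'n"
  assumes sT: "s \<le> T" and \<delta>_pos: "\<delta> > 0" and L_nonneg: "L \<ge> 0"
    and meas: "bounded_measurable {s..T} A" "bounded_measurable {s..T} B"
      "bounded_measurable {s..T} Bb" "bounded_measurable {s..T} q" "bounded_measurable {s..T} G"
    and bound: "\<And>t. t \<in> {s..T} \<Longrightarrow> norm (A t) \<le> L" "\<And>t. t \<in> {s..T} \<Longrightarrow> norm (B t) \<le> L"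
      "\<And>t. t \<in> {s..T} \<Longrightarrow> norm (Bb t) \<le> L" "\<And>t. t \<in> {s..T} \<Longrightarrow> norm (q t) \<le> L"
      "\<And>t. t \<in> {s..T} \<Longrightarrow> norm (G t) \<le> L"
    and q_psd: "\<And>t. t \<in> {s..T} \<Longrightarrow> q t \<in> psd_mats"
    and G_psd: "\<And>t. t \<in> {s..T} \<Longrightarrow> G t \<in> psd_mats"
    and M_pd: "M \<in> pd_mats" and M_bound: "norm M \<le> L"
begin

abbreviation past :: "(real \<Rightarrow> real^'n^'n) \<Rightarrow> real \<Rightarrow> real^'n^'n" where
  "past \<equiv> delayed s \<delta> (mat 1)"

text \<open>The affine part of minus the derivative of X, so that it acts as a growth rate when time
  runs back from T; Z is the slot of the delayed value.\<close>

definition lin :: "real \<Rightarrow> real^'n^'n \<Rightarrow> real^'n^'n \<Rightarrow> real^'n^'n" where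
  "lin t X Z = X ** transpose (A t) + A t ** X + B t ** X ** transpose (B t) + G t
    + Bb t ** Z ** transpose (Bb t)"

definition rhs :: "real \<Rightarrow> real^'n^'n \<Rightarrow> real^'n^'n \<Rightarrow> real^'n^'n" where
  "rhs t X Z = lin t X Z - 2 *\<^sub>R (X ** q t ** X)"

text \<open>A globally Lipschitz modification of \<^const>\<open>rhs\<close> with symmetric values, which agrees with it
  on positive semidefinite arguments of norm at most \<open>R\<close>.\<close>

definition trunc_rhs :: "real \<Rightarrow> real \<Rightarrow> real^'n^'n \<Rightarrow> real^'n^'n \<Rightarrow> real^'n^'n" where
  "trunc_rhs R t X Z = lin t (sym_part X) (closest_point psd_mats Z)
    - 2 *\<^sub>R (closest_point (cball 0 R) (sym_part X) ** q t ** closest_point (cball 0 R) (sym_part X))"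

definition sigma_solution :: "(real \<Rightarrow> real^'n^'n) \<Rightarrow> bool" where
  "sigma_solution X \<longleftrightarrow> (\<forall>t\<in>{s..T}. X t \<in> pd_mats) \<and>
    ode_solution_on s T X (\<lambda>t. - rhs t (X t) (past X t)) \<and> X T = M"

section \<open>Lipschitz and measurability properties of the truncated equation\<close>

lemma lin_diff:
  "lin t X Z - lin t X' Z' = (X - X') ** transpose (A t) + A t ** (X - X')
    + B t ** (X - X') ** transpose (B t) + Bb t ** (Z - Z') ** transpose (Bb t)"
  by (simp add: lin_def matrix_mult_simps)

lemma lin_lipschitz:
  assumes t: "t \<in> {s..T}"
  shows "norm (lin t X Z - lin t X' Z') \<le> (2 * L + L\<^sup>2) * norm (X - X') + L\<^sup>2 * norm (Z - Z')"
proof -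
  have "norm ((X - X') ** transpose (A t)) \<le> norm (X - X') * L"
    by (rule order_trans[OF norm_matrix_mult_le]) (use bound(1)[OF t] in \<open>auto intro: mult_left_mono\<close>)
  moreover have "norm (A t ** (X - X')) \<le> L * norm (X - X')"
    by (rule order_trans[OF norm_matrix_mult_le]) (use bound(1)[OF t] in \<open>auto intro: mult_right_mono\<close>)
  moreover have "norm (B t ** (X - X') ** transpose (B t)) \<le> L * norm (X - X') * L"
    by (rule norm_matrix_mult3_le) (use bound(2)[OF t] in auto)
  moreover have "norm (Bb t ** (Z - Z') ** transpose (Bb t)) \<le> L * norm (Z - Z') * L"
    by (rule norm_matrix_mult3_le) (use bound(3)[OF t] in auto)
  moreover have "norm (a + b + c + d) \<le> norm a + norm b + norm c + norm d" for a b c d :: "real^'n^'n"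
    by (meson add_mono norm_triangle_ineq order_refl order_trans)
  then have "norm (lin t X Z - lin t X' Z') \<le> norm ((X - X') ** transpose (A t))
      + norm (A t ** (X - X')) + norm (B t ** (X - X') ** transpose (B t))
      + norm (Bb t ** (Z - Z') ** transpose (Bb t))"
    unfolding lin_diff .
  ultimately have "norm (lin t X Z - lin t X' Z') \<le> norm (X - X') * L + L * norm (X - X')
      + L * norm (X - X') * L + L * norm (Z - Z') * L"
    by linarith
  then show ?thesis by (simp add: power2_eq_square algebra_simps)
qed

text \<open>Symmetrisation and both projections are nonexpansive. Telescoping the quadratic term
  gives \<open>2 * R * L\<close>, doubled by its coefficient 2; this is the only dependence on
  R.\<close>

lemma trunc_rhs_lipschitz:
  assumes t: "t \<in> {s..T}" and R: "R \<ge> 0"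
  shows "norm (trunc_rhs R t X Z - trunc_rhs R t X' Z')
    \<le> (2 * L + L\<^sup>2 + 4 * R * L) * norm (X - X') + L\<^sup>2 * norm (Z - Z')"
proof -
  define P where "P = closest_point (cball 0 R) (sym_part X)"
  define P' where "P' = closest_point (cball 0 R) (sym_part X')"
  have PP: "norm (P - P') \<le> norm (X - X')"
    using closest_point_lipschitz[of "cball 0 R" "sym_part X" "sym_part X'"] R
      norm_sym_part_le[of "X - X'"]
    by (simp add: P_def P'_def dist_norm sym_part_diff)
  have P: "norm P \<le> R" "norm P' \<le> R"
    using closest_point_in_set[of "cball 0 R"] R by (auto simp: P_def P'_def)
  have "norm ((P - P') ** q t ** P) \<le> norm (X - X') * L * R"
    by (rule norm_matrix_mult3_le) (use PP P bound(4)[OF t] in auto)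
  moreover have "norm (P' ** q t ** (P - P')) \<le> R * L * norm (X - X')"
    by (rule norm_matrix_mult3_le) (use PP P bound(4)[OF t] in auto)
  moreover have "P ** q t ** P - P' ** q t ** P' = (P - P') ** q t ** P + P' ** q t ** (P - P')"
    by (simp add: matrix_mult_simps)
  ultimately have quad: "norm (P ** q t ** P - P' ** q t ** P') \<le> 2 * R * L * norm (X - X')"
    using norm_triangle_ineq[of "(P - P') ** q t ** P" "P' ** q t ** (P - P')"] by (simp add: algebra_simps)
  have "norm (closest_point psd_mats Z - closest_point psd_mats Z') \<le> norm (Z - Z')"
    using closest_point_lipschitz[OF convex_psd closed_psd, of Z Z'] psd_zero by (auto simp: dist_norm)
  then have "L\<^sup>2 * norm (closest_point psd_mats Z - closest_point psd_mats Z') \<le> L\<^sup>2 * norm (Z - Z')"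
    by (rule mult_left_mono) simp
  moreover have "(2 * L + L\<^sup>2) * norm (sym_part X - sym_part X') \<le> (2 * L + L\<^sup>2) * norm (X - X')"
    unfolding sym_part_diff by (intro mult_left_mono norm_sym_part_le) (simp add: L_nonneg)
  ultimately have "norm (lin t (sym_part X) (closest_point psd_mats Z)
      - lin t (sym_part X') (closest_point psd_mats Z'))
      \<le> (2 * L + L\<^sup>2) * norm (X - X') + L\<^sup>2 * norm (Z - Z')"
    using lin_lipschitz[OF t, of "sym_part X" "closest_point psd_mats Z"
        "sym_part X'" "closest_point psd_mats Z'"] by linarith
  moreover have eq: "trunc_rhs R t X Z - trunc_rhs R t X' Z' =
      (lin t (sym_part X) (closest_point psd_mats Z) - lin t (sym_part X') (closest_point psd_mats Z'))
      - 2 *\<^sub>R (P ** q t ** P - P' ** q t ** P')"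
    by (simp add: trunc_rhs_def P_def P'_def algebra_simps)
  have "norm (trunc_rhs R t X Z - trunc_rhs R t X' Z')
      \<le> norm (lin t (sym_part X) (closest_point psd_mats Z) - lin t (sym_part X') (closest_point psd_mats Z'))
        + norm (2 *\<^sub>R (P ** q t ** P - P' ** q t ** P'))"
    unfolding eq by (rule norm_triangle_ineq4)
  ultimately have "norm (trunc_rhs R t X Z - trunc_rhs R t X' Z')
      \<le> (2 * L + L\<^sup>2) * norm (X - X') + L\<^sup>2 * norm (Z - Z') + 2 * (2 * R * L * norm (X - X'))"
    using quad by simp
  then show ?thesis by (simp add: distrib_right)
qed

lemma trunc_rhs_eq_rhs:
  assumes "X \<in> psd_mats" "norm X \<le> R" "Z \<in> psd_mats"
  shows "trunc_rhs R t X Z = rhs t X Z"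
  using assms by (simp add: trunc_rhs_def rhs_def closest_point_self sym_part_ident psd_mats_def[of])

lemma past_psd:
  assumes "\<And>t. t \<in> {s..T} \<Longrightarrow> X t \<in> psd_mats" "t \<in> {s..T}"
  shows "past X t \<in> psd_mats"
  using assms \<delta>_pos by (auto simp: delayed_def psd_mat_1)

lemma lin_measurable:
  assumes "bounded_measurable {s..T} X" "bounded_measurable {s..T} Z"
  shows "bounded_measurable {s..T} (\<lambda>t. lin t (X t) (Z t))"
  unfolding lin_def by (intro bounded_measurable_intros meas assms)

lemma trunc_rhs_measurable:
  assumes X: "continuous_on {s..T} X" and R: "R \<ge> 0"
  shows "bounded_measurable {s..T} (\<lambda>t. trunc_rhs R t (X t) (past X t))"
proof -
  have X': "bounded_measurable {s..T} (\<lambda>t. sym_part (X t))"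
    by (intro bounded_measurable_continuous continuous_intros X)
  have P: "bounded_measurable {s..T} (\<lambda>t. closest_point (cball 0 R) (sym_part (X t)))"
    by (rule bounded_measurable_compose[OF continuous_on_closest_point X']) (use R in auto)
  have Z: "bounded_measurable {s..T} (\<lambda>t. closest_point psd_mats (past X t))"
    by (rule bounded_measurable_compose[OF continuous_on_closest_point
          bounded_measurable_delayed[OF X \<delta>_pos]]) (use convex_psd closed_psd psd_zero in auto)
  show ?thesis
    unfolding trunc_rhs_def
    by (intro bounded_measurable_diff bounded_measurable_scaleR bounded_measurable_matrix_mult
        lin_measurable X' P Z meas)
qed

lemma rhs_measurable:
  assumes X: "continuous_on {s..T} X"
  shows "bounded_measurable {s..T} (\<lambda>t. rhs t (X t) (past X t))"
  unfolding rhs_def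
  by (intro bounded_measurable_diff bounded_measurable_scaleR bounded_measurable_matrix_mult
      lin_measurable bounded_measurable_continuous X bounded_measurable_delayed meas \<delta>_pos)

text \<open>On the cone the norm is controlled by the trace, to which the quadratic term \<open>\<psi>\<close>
  contributes with a favourable sign; hence the bound does not depend on the truncation.\<close>

lemma a_priori_bound:
  assumes \<theta>: "\<theta> > 0" "2 * ((real CARD('n))^3 * (2 * L + L\<^sup>2) + 2 * ((real CARD('n))^3 * L\<^sup>2)) \<le> \<theta>"
      "exp (\<theta> * \<delta>) \<le> 2"
    and sol: "ode_solution_on s T X (\<lambda>t. - (lin t (X t) (past X t) - \<psi> t))" and XT: "X T = M"
    and psd: "\<And>t. t \<in> {s..T} \<Longrightarrow> X t \<in> psd_mats" and \<psi>: "\<And>t. t \<in> {s..T} \<Longrightarrow> \<psi> t \<in> psd_mats"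
    and t: "t \<in> {s..T}"
  shows "norm (X t) \<le> (real CARD('n))\<^sup>2 * (2 * (CARD('n) * L + (T - s) * (CARD('n) * L
    + (real CARD('n))^3 * L\<^sup>2 * CARD('n))) * exp (\<theta> * (T - s)))"
proof -
  define N where "N = real CARD('n)"
  have N0: "N \<ge> 0" by (simp add: N_def)
  note tr_bl = bounded_linear_trace[where 'n = 'n]
  have tr_le: "trace Y \<le> N * norm Y" for Y :: "real^'n^'n"
    using abs_trace_le[of Y] by (simp add: N_def)
  \<comment> \<open>Passing from trace to norm costs N and from norm back to trace N squared, whence
    the factor N cubed in the rates.\<close>
  have tr_le': "trace Y \<le> N * y" if "norm Y \<le> y" for Y :: "real^'n^'n" and y
    using order_trans[OF tr_le mult_left_mono[OF that N0]] .
  have nr: "norm Y \<le> N\<^sup>2 * trace Y" if "Y \<in> psd_mats" for Y :: "real^'n^'n"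
    using norm_psd_le_trace[OF that] by (simp add: N_def)
  have "trace (X t) \<le> 2 * (N * L + (T - s) * (N * L + N^3 * L\<^sup>2 * N)) * exp (\<theta> * (T - s))"
  proof (rule delayed_integral_inequality[OF sT \<delta>_pos _ _ _ _ _ \<theta>(1) _ \<theta>(3) _ _ _ t])
    show "2 * (N^3 * (2 * L + L\<^sup>2) + 2 * (N^3 * L\<^sup>2)) \<le> \<theta>" using \<theta>(2) by (simp add: N_def)
    show "continuous_on {s..T} (\<lambda>t. trace (X t))"
      using sol by (auto simp: ode_solution_on_def intro!: bounded_linear.continuous_on[OF tr_bl])
    show "0 \<le> trace (X t)" if "t \<in> {s..T}" for t by (rule trace_psd_nonneg[OF psd[OF that]])
  next
    fix t \<phi> I assume t: "t \<in> {s..T}" and \<phi>: "(\<phi> has_integral I) {t..T}"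
      and le: "\<And>r. r \<in> {t..T} \<Longrightarrow> N^3 * (2 * L + L\<^sup>2) * trace (X r)
          + N^3 * L\<^sup>2 * delayed s \<delta> N (\<lambda>t. trace (X t)) r + N * L \<le> \<phi> r"
    have "((\<lambda>r. lin r (X r) (past X r) - \<psi> r) has_integral (X t - M)) {t..T}"
      using sol t XT unfolding ode_solution_on_backward[OF sT] by simp
    from has_integral_linear[OF this tr_bl]
    have "((\<lambda>r. trace (lin r (X r) (past X r) - \<psi> r)) has_integral trace (X t - M)) {t..T}"
      by (simp add: o_def)
    moreover have "trace (lin r (X r) (past X r) - \<psi> r) \<le> \<phi> r" if r: "r \<in> {t..T}" for r
    proof -
      have r': "r \<in> {s..T}" using r t by auto
      define x where "x = N\<^sup>2 * trace (X r)"
      define z where "z = N\<^sup>2 * trace (past X r)"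
      have x: "norm (X r) \<le> x" and z: "norm (past X r) \<le> z"
        unfolding x_def z_def by (rule nr[OF psd[OF r']], rule nr[OF past_psd[OF psd r']])
      have "trace (X r ** transpose (A r)) \<le> N * (x * L)"
        by (rule tr_le', rule order_trans[OF norm_matrix_mult_le], rule mult_mono)
          (use x bound(1)[OF r'] order_trans[OF norm_ge_zero x] in auto)
      moreover have "trace (A r ** X r) \<le> N * (L * x)"
        by (rule tr_le', rule order_trans[OF norm_matrix_mult_le], rule mult_mono)
          (use x bound(1)[OF r'] L_nonneg in auto)
      moreover have "trace (B r ** X r ** transpose (B r)) \<le> N * (L * x * L)"
        by (rule tr_le', rule norm_matrix_mult3_le) (use x bound(2)[OF r'] in auto)
      moreover have "trace (Bb r ** past X r ** transpose (Bb r)) \<le> N * (L * z * L)"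
        by (rule tr_le', rule norm_matrix_mult3_le) (use z bound(3)[OF r'] in auto)
      moreover have "trace (G r) \<le> N * L" by (rule tr_le'[OF bound(5)[OF r']])
      \<comment> \<open>Only the sign of \<psi> enters, so one estimate serves both the truncated
        and the original quadratic term.\<close>
      moreover have "0 \<le> trace (\<psi> r)" by (rule trace_psd_nonneg[OF \<psi>[OF r']])
      moreover have "trace (lin r (X r) (past X r) - \<psi> r) = trace (X r ** transpose (A r))
          + trace (A r ** X r) + trace (B r ** X r ** transpose (B r)) + trace (G r)
          + trace (Bb r ** past X r ** transpose (Bb r)) - trace (\<psi> r)"
        unfolding lin_def by (simp add: trace_add trace_sub)
      ultimately have "trace (lin r (X r) (past X r) - \<psi> r)
          \<le> N * (x * L) + N * (L * x) + N * (L * x * L) + N * L + N * (L * z * L)"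
        by linarith
      also have "\<dots> = N^3 * (2 * L + L\<^sup>2) * trace (X r) + N^3 * L\<^sup>2 * trace (past X r) + N * L"
        by (simp add: x_def z_def power2_eq_square power3_eq_cube algebra_simps)
      \<comment> \<open>The history of the trace is the constant N, the trace of the
        identity.\<close>
      also have "trace (past X r) = delayed s \<delta> N (\<lambda>t. trace (X t)) r"
        by (simp add: delayed_def N_def trace_I)
      finally show ?thesis using le[OF r] by linarith
    qed
    ultimately have "trace (X t - M) \<le> I" by (rule has_integral_le[OF _ \<phi>])
    then show "trace (X t) \<le> N * L + I" using tr_le'[OF M_bound] by (simp add: trace_sub)
  qed (use N0 L_nonneg in auto)
  then have "N\<^sup>2 * trace (X t) \<le> N\<^sup>2 * (2 * (N * L + (T - s) * (N * L + N^3 * L\<^sup>2 * N)) * exp (\<theta> * (T - s)))"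
    by (rule mult_left_mono) simp
  with nr[OF psd[OF t]] show ?thesis unfolding N_def by linarith
qed

text \<open>The growth hypothesis of \<open>pd_backward\<close>. After negation the B, G and delayed
  terms are nonpositive, the last thanks to the projection. The A terms contain X v by symmetry; in
  the quadratic term one factor P v is bounded by the norm of X v and the other by R times the norm
  of v.\<close>

lemma trunc_rhs_growth:
  assumes t: "t \<in> {s..T}" and R: "R \<ge> 0" and X: "X \<in> psd_mats"
  shows "v \<bullet> (- trunc_rhs R t X Z *v v) \<le> (2 * L + 2 * L * R) * norm v * norm (X *v v)"
proof -
  have sym: "sym_part X = X" using X by (simp add: psd_mats_def sym_part_ident)
  define P where "P = closest_point (cball 0 R) X"
  obtain \<rho> where \<rho>: "0 \<le> \<rho>" "\<rho> \<le> 1" "P = \<rho> *\<^sub>R X"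
    using closest_point_cball_radial[OF R] unfolding P_def by blast
  have P_norm: "norm P \<le> R"
    using closest_point_in_set[of "cball 0 R"] R by (auto simp: P_def)
  have P_sym: "transpose P = P" using X \<rho> by (simp add: psd_mats_def sym_mats_def transpose_simps)
  have X_sym: "transpose X = X" using X by (simp add: psd_mats_def sym_mats_def)
  have Pv: "norm (P *v v) \<le> R * norm v" "norm (P *v v) \<le> norm (X *v v)"
  proof -
    show "norm (P *v v) \<le> R * norm v"
      by (rule order_trans[OF norm_matrix_vector_mult_le mult_right_mono[OF P_norm]]) simp
    show "norm (P *v v) \<le> norm (X *v v)"
      using \<rho> mult_right_mono[of \<rho> 1 "norm (X *v v)"] by (simp add: matrix_vector_simps)
  qed
  have mv: "norm (C *v w) \<le> L * norm w" if "norm C \<le> L" for C :: "real^'n^'n" and w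
    by (rule order_trans[OF norm_matrix_vector_mult_le mult_right_mono[OF that]]) simp
  have "- (v \<bullet> (X ** transpose (A t) *v v)) \<le> norm (X *v v) * (L * norm v)"
  proof -
    have "v \<bullet> (X ** transpose (A t) *v v) = (X *v v) \<bullet> (transpose (A t) *v v)"
      using inner_matrix_transpose[of v X "transpose (A t) *v v"]
      unfolding matrix_vector_mul_assoc X_sym .
    moreover have "\<bar>(X *v v) \<bullet> (transpose (A t) *v v)\<bar> \<le> norm (X *v v) * (L * norm v)"
      by (rule order_trans[OF Cauchy_Schwarz_ineq2 mult_left_mono[OF mv]]) (use bound(1)[OF t] in auto)
    ultimately show ?thesis by linarith
  qed
  moreover have "- (v \<bullet> (A t ** X *v v)) \<le> norm v * (L * norm (X *v v))"
  proof -
    have "\<bar>v \<bullet> (A t *v (X *v v))\<bar> \<le> norm v * (L * norm (X *v v))"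
      by (rule order_trans[OF Cauchy_Schwarz_ineq2 mult_left_mono[OF mv]]) (use bound(1)[OF t] in auto)
    then show ?thesis by (simp add: matrix_vector_mul_assoc)
  qed
  moreover have "v \<bullet> (P ** q t ** P *v v) \<le> (R * norm v) * (L * norm (X *v v))"
  proof -
    have "v \<bullet> (P ** q t ** P *v v) = (P *v v) \<bullet> (q t *v (P *v v))"
      using inner_matrix_transpose[of v P "q t *v (P *v v)"]
      unfolding matrix_vector_mul_assoc matrix_mul_assoc P_sym by simp
    also have "\<dots> \<le> norm (P *v v) * norm (q t *v (P *v v))" by (rule norm_cauchy_schwarz)
    also have "\<dots> \<le> (R * norm v) * (L * norm (X *v v))"
    proof (rule mult_mono)
      show "norm (q t *v (P *v v)) \<le> L * norm (X *v v)"
        by (rule order_trans[OF mv mult_left_mono[OF Pv(2)]]) (use bound(4)[OF t] L_nonneg in auto)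
    qed (use Pv R in auto)
    finally show ?thesis .
  qed
  moreover have "0 \<le> v \<bullet> (B t ** X ** transpose (B t) *v v)"
    using psd_congruence[OF X, of "B t"] by (simp add: psd_mats_def)
  moreover have "0 \<le> v \<bullet> (G t *v v)" using G_psd[OF t] by (simp add: psd_mats_def)
  moreover have "0 \<le> v \<bullet> (Bb t ** closest_point psd_mats Z ** transpose (Bb t) *v v)"
    using psd_congruence[OF closest_point_psd, of "Bb t" Z] by (simp only: psd_mats_def[where 'n = 'n] mem_Collect_eq)
  moreover have "v \<bullet> (- trunc_rhs R t X Z *v v) = - (v \<bullet> (X ** transpose (A t) *v v))
      - (v \<bullet> (A t ** X *v v)) - v \<bullet> (B t ** X ** transpose (B t) *v v) - v \<bullet> (G t *v v)
      - v \<bullet> (Bb t ** closest_point psd_mats Z ** transpose (Bb t) *v v)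
      + 2 * (v \<bullet> (P ** q t ** P *v v))"
    unfolding trunc_rhs_def lin_def sym P_def[symmetric]
    by (simp only: matrix_vector_simps inner_simps) (simp add: inner_diff_right inner_add_right)
  ultimately have "v \<bullet> (- trunc_rhs R t X Z *v v) \<le> norm (X *v v) * (L * norm v)
      + norm v * (L * norm (X *v v)) + 2 * ((R * norm v) * (L * norm (X *v v)))"
    by linarith
  then show ?thesis by (simp add: algebra_simps)
qed

lemma trunc_rhs_sym:
  assumes "t \<in> {s..T}" "R \<ge> 0" shows "trunc_rhs R t X Z \<in> sym_mats"
proof -
  have "q t \<in> sym_mats" "G t \<in> sym_mats" "closest_point psd_mats Z \<in> sym_mats"
    using q_psd[OF assms(1)] G_psd[OF assms(1)] closest_point_psd[of Z]
    unfolding psd_mats_def by blast+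
  moreover have "sym_part X ** transpose (A t) + A t ** sym_part X \<in> sym_mats"
    using sym_part_in_sym_mats[of X] by (simp add: sym_mats_def transpose_simps add.commute)
  ultimately show ?thesis
    unfolding trunc_rhs_def lin_def
    by - (assumption | rule sym_mats_intros sym_part_in_sym_mats closest_point_cball_sym assms)+
qed

text \<open>The trace controls the norm only on the cone, so positivity must precede the bound:
  symmetry, positivity, norm at most R, and only then removal of the truncation.\<close>

theorem sigma_solution_exists_unique:
  assumes \<theta>1: "\<theta>1 > 0" "exp (\<theta>1 * \<delta>) \<le> 2"
      "2 * ((real CARD('n))^3 * (2 * L + L\<^sup>2) + 2 * ((real CARD('n))^3 * L\<^sup>2)) \<le> \<theta>1"
    and R: "(real CARD('n))\<^sup>2 * (2 * (CARD('n) * L + (T - s) * (CARD('n) * L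
      + (real CARD('n))^3 * L\<^sup>2 * CARD('n))) * exp (\<theta>1 * (T - s))) \<le> R" "R \<ge> 0"
    and \<theta>: "\<theta> > 0" "exp (\<theta> * \<delta>) \<le> 2" "2 * ((2 * L + L\<^sup>2 + 4 * R * L) + 2 * L\<^sup>2) \<le> \<theta>"
  shows "\<exists>X. sigma_solution X \<and> (\<forall>Y. sigma_solution Y \<longrightarrow> (\<forall>t\<in>{s..T}. Y t = X t))"
proof -
  have k: "0 \<le> 2 * L + L\<^sup>2 + 4 * R * L" using L_nonneg R by simp
  have l: "0 \<le> L\<^sup>2" by simp
  note lip = trunc_rhs_lipschitz[OF _ R(2)]
  have int: "(\<lambda>r. trunc_rhs R r (x r) (past x r)) integrable_on {s..T}"
    if "continuous_on {s..T} x" for x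
    by (intro bounded_measurable_integrable[OF trunc_rhs_measurable] R that) auto
  obtain X where X: "continuous_on {s..T} X" and X_int: "\<And>t. t \<in> {s..T} \<Longrightarrow>
      ((\<lambda>r. trunc_rhs R r (X r) (past X r)) has_integral (X t - M)) {t..T}"
    using delay_equation_exists[where M = M, OF sT \<delta>_pos k l \<theta>(1,3,2) lip int] by blast
  have XT: "X T = M"
    using X_int[of T] sT has_integral_unique[OF _ has_integral_refl(2)[of _ T]]
    by (force simp: box_real[symmetric] simp del: box_real)
  have X_sol: "ode_solution_on s T X (\<lambda>t. - trunc_rhs R t (X t) (past X t))"
    unfolding ode_solution_on_backward[OF sT] using X X_int XT by simp
  have X_sym: "X t \<in> sym_mats" if t: "t \<in> {s..T}" for t
  proof -
    \<comment> \<open>Transposing leaves the integrand unchanged because its values are symmetric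
      for every argument; uniqueness of the integral then gives symmetry of X.\<close>
    have "((\<lambda>r. transpose (trunc_rhs R r (X r) (past X r))) has_integral transpose (X t - M)) {t..T}"
      using has_integral_linear[OF X_int[OF t] bounded_linear_transpose] by (simp add: o_def)
    then have "((\<lambda>r. trunc_rhs R r (X r) (past X r)) has_integral transpose (X t - M)) {t..T}"
      by (rule has_integral_eq[rotated]) (use trunc_rhs_sym[OF _ R(2)] t in \<open>auto simp: sym_mats_def\<close>)
    then have "transpose (X t - M) = X t - M" using X_int[OF t] by (rule has_integral_unique)
    then show ?thesis using M_pd by (simp add: sym_mats_def pd_mats_def transpose_simps)
  qed
  have X_pd: "X t \<in> pd_mats" if "t \<in> {s..T}" for t
  proof (rule pd_backward[OF X_sol X_sym _ _ _ that])
    show "X T \<in> pd_mats" using M_pd by (simp add: XT)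
    show "0 \<le> 2 * L + 2 * L * R" using L_nonneg R by simp
  qed (use trunc_rhs_growth R in auto)
  have X_psd: "X t \<in> psd_mats" if "t \<in> {s..T}" for t
    by (rule pd_imp_psd[OF X_pd[OF that]])
  have agree: "trunc_rhs R t (Y t) (past Y t) = rhs t (Y t) (past Y t)"
    if "\<And>t. t \<in> {s..T} \<Longrightarrow> Y t \<in> psd_mats" "\<And>t. t \<in> {s..T} \<Longrightarrow> norm (Y t) \<le> R" "t \<in> {s..T}" for Y t
    by (intro trunc_rhs_eq_rhs that past_psd)
  have X_le: "norm (X t) \<le> R" if t: "t \<in> {s..T}" for t
  proof -
    \<comment> \<open>The truncated quadratic term is P q P with P symmetric, a congruence of q, and
      thus an admissible \<psi>.\<close>
    define P where "P r = closest_point (cball 0 R) (X r)" for r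
    have P_sym: "transpose (P r) = P r" if "r \<in> {s..T}" for r
      using closest_point_cball_sym[OF X_sym[OF that] R(2)] by (simp add: P_def sym_mats_def)
    have past_in: "past X t \<in> psd_mats" if "t \<in> {s..T}" for t
      by (rule past_psd[OF X_psd that])
    have "ode_solution_on s T X (\<lambda>t. - (lin t (X t) (past X t) - 2 *\<^sub>R (P t ** q t ** P t)))"
      by (rule ode_solution_on_cong[OF X_sol])
        (simp add: trunc_rhs_def P_def sym_part_ident[OF X_sym] closest_point_self past_in)
    then show ?thesis
    proof (rule order_trans[OF a_priori_bound[where X = X and \<psi> = "\<lambda>r. 2 *\<^sub>R (P r ** q r ** P r)",
            OF \<theta>1(1,3,2) _ XT _ _ t] R(1)])
      show "X r \<in> psd_mats" if "r \<in> {s..T}" for r by (rule X_psd[OF that])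
      show "2 *\<^sub>R (P r ** q r ** P r) \<in> psd_mats" if "r \<in> {s..T}" for r
        using psd_scaleR[OF psd_congruence[OF q_psd[OF that], of "P r"], of 2] P_sym[OF that] by simp
    qed
  qed
  have "ode_solution_on s T X (\<lambda>t. - rhs t (X t) (past X t))"
    by (rule ode_solution_on_cong[OF X_sol], rule arg_cong[of _ _ uminus], rule agree)
      (auto intro: X_psd X_le)
  then have "sigma_solution X" using X_pd XT by (simp add: sigma_solution_def)
  \<comment> \<open>A competitor satisfies the same a priori bound, hence solves the truncated
    equation as well, where uniqueness is available.\<close>
  moreover have "Y t = X t" if Y: "sigma_solution Y" and t: "t \<in> {s..T}" for Y t
  proof -
    have Y_psd: "Y r \<in> psd_mats" if "r \<in> {s..T}" for r
      using Y that by (auto simp: sigma_solution_def intro: pd_imp_psd)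
    have Y_sol: "ode_solution_on s T Y (\<lambda>t. - rhs t (Y t) (past Y t))" and YT: "Y T = M"
      using Y by (auto simp: sigma_solution_def)
    have Y_le: "norm (Y r) \<le> R" if r: "r \<in> {s..T}" for r
    proof (rule order_trans[OF a_priori_bound[where X = Y and \<psi> = "\<lambda>r. 2 *\<^sub>R (Y r ** q r ** Y r)",
            OF \<theta>1(1,3,2) _ YT Y_psd _ r] R(1)])
      show "ode_solution_on s T Y (\<lambda>t. - (lin t (Y t) (past Y t) - 2 *\<^sub>R (Y t ** q t ** Y t)))"
        using Y_sol by (simp add: rhs_def)
      show "2 *\<^sub>R (Y r ** q r ** Y r) \<in> psd_mats" if "r \<in> {s..T}" for r
        using psd_scaleR[OF psd_congruence[OF q_psd[OF that], of "Y r"], of 2] Y_psd[OF that]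
        by (simp add: psd_mats_def[of] sym_mats_def)
    qed
    have "ode_solution_on s T Y (\<lambda>t. - trunc_rhs R t (Y t) (past Y t))"
      by (rule ode_solution_on_cong[OF Y_sol], rule arg_cong[of _ _ uminus], rule agree[symmetric])
        (auto intro: Y_psd Y_le)
    then have Y2: "continuous_on {s..T} Y" "\<And>t. t \<in> {s..T} \<Longrightarrow>
        ((\<lambda>r. trunc_rhs R r (Y r) (past Y r)) has_integral (Y t - M)) {t..T}"
      unfolding ode_solution_on_backward[OF sT] using YT by auto
    show ?thesis
      by (rule delay_equation_unique[OF sT \<delta>_pos k l \<theta>(1,3,2) lip Y2 X X_int t])
  qed
  ultimately show ?thesis by blast
qed

end

section \<open>Passage between the equation for the inverse and the Riccati equation\<close>

context sigma_equation begin

definition ric :: "real \<Rightarrow> real^'n^'n \<Rightarrow> real^'n^'n \<Rightarrow> real^'n^'n" where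
  "ric t P W = P ** A t + transpose (A t) ** P - 2 *\<^sub>R q t
    + P ** B t ** matrix_inv P ** transpose (B t) ** P + P ** G t ** P
    + P ** Bb t ** W ** transpose (Bb t) ** P"

definition ric_solution :: "(real \<Rightarrow> real^'n^'n) \<Rightarrow> bool" where
  "ric_solution P \<longleftrightarrow> (\<forall>t\<in>{s..T}. P t \<in> sym_mats \<and> invertible (P t)) \<and>
    ode_solution_on s T P (\<lambda>t. ric t (P t) (matrix_inv (past P t))) \<and> P T = matrix_inv M"

text \<open>With X = P^-1 one has P' = -P X' P, so conjugation by P is the whole change of
  variables; the delayed value W is carried along as a free parameter.\<close>

lemma conjugate_rhs:
  assumes P: "invertible P"
  shows "P ** rhs t (matrix_inv P) W ** P = ric t P W"
proof -
  have inv: "P ** (matrix_inv P ** Y) = Y" "matrix_inv P ** (P ** Y) = Y" for Y :: "real^'n^'n"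
    using matrix_inv_left_inverse[OF P] matrix_inv_right_inverse[OF P] by (simp_all add: matrix_mul_assoc)
  show ?thesis
    unfolding rhs_def lin_def ric_def
    by (simp add: matrix_mult_simps inv matrix_inv_left_inverse[OF P] flip: matrix_mul_assoc)
qed

lemma conjugate_ric:
  assumes P: "invertible P"
  shows "matrix_inv P ** ric t P W ** matrix_inv P = rhs t (matrix_inv P) W"
  unfolding conjugate_rhs[OF P, symmetric]
  by (simp add: matrix_mul_assoc matrix_inv_left_inverse[OF P])
    (simp add: matrix_inv_right_inverse[OF P] flip: matrix_mul_assoc)

lemma past_matrix_inv: "past (\<lambda>t. matrix_inv (X t)) t = matrix_inv (past X t)"
  by (simp add: delayed_def)

lemma sigma_solution_imp_ric_solution:
  assumes X: "sigma_solution X"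
  shows "ric_solution (\<lambda>t. matrix_inv (X t))" "\<And>t. t \<in> {s..T} \<Longrightarrow> matrix_inv (X t) \<in> pd_mats"
proof -
  have pd: "X t \<in> pd_mats" if "t \<in> {s..T}" for t using X that by (simp add: sigma_solution_def)
  note inv = pd_imp_invertible[OF pd]
  have sol: "ode_solution_on s T X (\<lambda>t. - rhs t (X t) (past X t))"
    using X by (simp add: sigma_solution_def)
  show pd': "matrix_inv (X t) \<in> pd_mats" if "t \<in> {s..T}" for t
    by (rule pd_matrix_inv[OF pd[OF that]])
  have "continuous_on {s..T} X" using sol by (simp add: ode_solution_on_def)
  then have "ode_solution_on s T (\<lambda>t. matrix_inv (X t))
      (\<lambda>t. - (matrix_inv (X t) ** (- rhs t (X t) (past X t)) ** matrix_inv (X t)))"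
    by (intro ode_solution_on_matrix_inv[OF sol] inv bounded_measurable_uminus rhs_measurable)
  then have "ode_solution_on s T (\<lambda>t. matrix_inv (X t))
      (\<lambda>t. ric t (matrix_inv (X t)) (matrix_inv (past (\<lambda>t. matrix_inv (X t)) t)))"
  proof (rule ode_solution_on_cong)
    fix t assume t: "t \<in> {s..T}"
    \<comment> \<open>The delayed value is inverted twice, so it must be invertible also where it is
      the history value.\<close>
    have "invertible (mat 1 :: real^'n^'n)"
      unfolding invertible_def by (intro exI[of _ "mat 1"]) simp
    then have "invertible (past X t)"
      using inv t \<delta>_pos by (auto simp: delayed_def)
    then show "- (matrix_inv (X t) ** (- rhs t (X t) (past X t)) ** matrix_inv (X t))
        = ric t (matrix_inv (X t)) (matrix_inv (past (\<lambda>t. matrix_inv (X t)) t))"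
      using conjugate_rhs[OF invertible_matrix_inv[OF inv[OF t]], of t "past X t"]
      by (simp add: past_matrix_inv matrix_inv_matrix_inv inv[OF t] matrix_mult_simps)
  qed
  then show "ric_solution (\<lambda>t. matrix_inv (X t))"
    using pd' X unfolding ric_solution_def sigma_solution_def
    by (auto simp: pd_mats_def pd_imp_invertible[OF pd'])
qed

text \<open>A symmetric invertible P starting from the positive definite inverse of M stays positive
  definite: an exit from the cone would produce a nonzero kernel vector.\<close>

lemma ric_solution_imp_sigma_solution:
  assumes P: "ric_solution P"
  shows "sigma_solution (\<lambda>t. matrix_inv (P t))"
proof -
  have sol: "ode_solution_on s T P (\<lambda>t. ric t (P t) (matrix_inv (past P t)))"
    and PT: "P T = matrix_inv M" and inv: "\<And>t. t \<in> {s..T} \<Longrightarrow> invertible (P t)"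
    and sym: "\<And>t. t \<in> {s..T} \<Longrightarrow> P t \<in> sym_mats"
    using P by (auto simp: ric_solution_def)
  have contP: "continuous_on {s..T} P" using sol by (simp add: ode_solution_on_def)
  have contI: "continuous_on {s..T} (\<lambda>t. matrix_inv (P t))"
    by (intro continuous_on_matrix_inv contP inv)
  have pd: "P t \<in> pd_mats" if t: "t \<in> {s..T}" for t
  proof (rule ccontr)
    assume "P t \<notin> pd_mats"
    moreover have "P T \<in> pd_mats" using pd_matrix_inv[OF M_pd] by (simp add: PT)
    ultimately obtain t0 v where t0: "t0 \<in> {s..<T}" and v: "v \<noteq> 0" "P t0 *v v = 0"
      using first_exit_from_pd[OF contP sym _ t] by blast
    have "matrix_inv (P t0) ** P t0 = mat 1"
      by (rule matrix_inv_left_inverse[OF inv]) (use t0 in auto)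
    then have "matrix_inv (P t0) *v (P t0 *v v) = v"
      unfolding matrix_vector_mul_assoc by simp
    then show False using v by (simp add: matrix_vector_simps)
  qed
  have "bounded_measurable {s..T} (\<lambda>t. ric t (P t) (past (\<lambda>t. matrix_inv (P t)) t))"
    unfolding ric_def
    by (intro bounded_measurable_add bounded_measurable_diff bounded_measurable_scaleR
        bounded_measurable_matrix_mult bounded_measurable_transpose meas
        bounded_measurable_continuous[OF contP] bounded_measurable_continuous[OF contI]
        bounded_measurable_delayed[OF contI] \<delta>_pos)
  then have "bounded_measurable {s..T} (\<lambda>t. ric t (P t) (matrix_inv (past P t)))"
    unfolding past_matrix_inv .
  then have "ode_solution_on s T (\<lambda>t. matrix_inv (P t))
      (\<lambda>t. - (matrix_inv (P t) ** ric t (P t) (matrix_inv (past P t)) ** matrix_inv (P t)))"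
    by (intro ode_solution_on_matrix_inv[OF sol] inv)
  then have "ode_solution_on s T (\<lambda>t. matrix_inv (P t))
      (\<lambda>t. - rhs t (matrix_inv (P t)) (past (\<lambda>t. matrix_inv (P t)) t))"
    by (rule ode_solution_on_cong) (simp add: conjugate_ric inv past_matrix_inv)
  then show ?thesis
    using pd_matrix_inv[OF pd] by (simp add: sigma_solution_def PT matrix_inv_matrix_inv pd_imp_invertible[OF M_pd])
qed

end

section \<open>The Riccati equation\<close>

definition coercive_mats :: "real \<Rightarrow> (real^'d^'d) set" where
  "coercive_mats c = {X. X - c *\<^sub>R mat 1 \<in> psd_mats}"

text \<open>The hypotheses on the weights hold almost everywhere only, and \<^const>\<open>matrix_inv\<close> is
  unspecified on singular matrices; on the exceptional null sets the weights are reset to zero.\<close>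

definition regular_Q :: "('n::finite, 'd::finite) lq_data \<Rightarrow> real \<Rightarrow> real \<Rightarrow> real^'n^'n" where
  "regular_Q D \<delta> t = (if Qsum D \<delta> t \<in> psd_mats then Qsum D \<delta> t else 0)"

definition regular_Ninv :: "('n::finite, 'd::finite) lq_data \<Rightarrow> real \<Rightarrow> real \<Rightarrow> real \<Rightarrow> real^'d^'d" where
  "regular_Ninv D \<alpha> \<delta> t = (if calN D \<delta> t \<in> coercive_mats (2 * \<alpha>) then matrix_inv (calN D \<delta> t) else 0)"

definition regular_G :: "('n::finite, 'd::finite) lq_data \<Rightarrow> real \<Rightarrow> real \<Rightarrow> real \<Rightarrow> real^'n^'n" where
  "regular_G D \<alpha> \<delta> t = cC D t ** regular_Ninv D \<alpha> \<delta> t ** transpose (cC D t)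
    + cCbar D t ** regular_Ninv D \<alpha> \<delta> (t - \<delta>) ** transpose (cCbar D t)"

lemma closed_coercive_mats: "closed (coercive_mats c :: (real^'d^'d) set)"
proof -
  have "closed ((\<lambda>X :: real^'d^'d. X - c *\<^sub>R mat 1) -` psd_mats)"
    by (intro closed_vimage closed_psd continuous_intros)
  then show ?thesis by (simp add: coercive_mats_def vimage_def)
qed

lemma regular_Ninv_psd:
  assumes "\<alpha> > 0" shows "regular_Ninv D \<alpha> \<delta> t \<in> psd_mats"
  using assms pd_imp_psd[OF pd_matrix_inv[OF coercive_pd[of "calN D \<delta> t" "2 * \<alpha>"]]]
  by (simp add: regular_Ninv_def coercive_mats_def psd_zero)

lemma norm_regular_Ninv_le:
  fixes D :: "('n::finite, 'd::finite) lq_data"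
  assumes "\<alpha> > 0" shows "norm (regular_Ninv D \<alpha> \<delta> t) \<le> CARD('d) / (2 * \<alpha>)"
  using assms norm_matrix_inv_coercive[of "calN D \<delta> t" "2 * \<alpha>"]
  by (simp add: regular_Ninv_def coercive_mats_def)

text \<open>In L, twice K bounds the sum of the Q weights. The second summand bounds G: it has two
  terms, each with an inverse of norm at most \<open>CARD('d) / (2 * \<alpha>)\<close>, since
  \<open>calN\<close> is twice the coercive sum.\<close>

lemma lq_setting_sigma_equation:
  fixes D :: "('n::finite, 'd::finite) lq_data"
  assumes lq: "lq_setting T K \<alpha> \<delta> s D" and pos: "\<alpha> > 0" "\<delta> > 0" and sT: "s \<le> T"
    and M: "M \<in> pd_mats" "norm M \<le> K"
  shows "sigma_equation s T \<delta> (2 * \<bar>K\<bar> + K\<^sup>2 * (CARD('d) / \<alpha>)) (cA D) (cB D) (cBbar D)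
    (regular_Q D \<delta>) (regular_G D \<alpha> \<delta>) M"
proof -
  define L where "L = 2 * \<bar>K\<bar> + K\<^sup>2 * (CARD('d) / \<alpha>)"
  have K0: "K \<ge> 0" using M(2) norm_ge_zero order_trans by blast
  have L: "K \<le> L" "2 * K \<le> L" "K\<^sup>2 * (CARD('d) / \<alpha>) \<le> L" "0 \<le> L"
    using K0 pos by (auto simp: L_def intro: add_increasing2 mult_nonneg_nonneg)
  have bdd: "bdd_meas_on {s..T} K (cA D)" "bdd_meas_on {s..T} K (cB D)"
      "bdd_meas_on {s..T + \<delta>} K (cBbar D)" "bdd_meas_on {s..T} K (cC D)" "bdd_meas_on {s..T} K (cCbar D)"
      "bdd_meas_on {s - \<delta>..T} K (cQ D)" "bdd_meas_on {s..T + \<delta>} K (cQbar D)"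
      "bdd_meas_on {s - \<delta>..T} K (cN D)" "bdd_meas_on {s..T + \<delta>} K (cNbar D)"
    using lq by (auto simp: lq_setting_def)
  note bm = bdd[THEN bdd_meas_on_imp]
  have norm_le: "\<And>t. t \<in> {s..T} \<Longrightarrow> norm (cA D t) \<le> K" "\<And>t. t \<in> {s..T} \<Longrightarrow> norm (cB D t) \<le> K"
      "\<And>t. t \<in> {s..T} \<Longrightarrow> norm (cBbar D t) \<le> K" "\<And>t. t \<in> {s..T} \<Longrightarrow> norm (cC D t) \<le> K"
      "\<And>t. t \<in> {s..T} \<Longrightarrow> norm (cCbar D t) \<le> K" "\<And>t. t \<in> {s..T} \<Longrightarrow> norm (cQ D t) \<le> K"
      "\<And>t. t \<in> {s..T} \<Longrightarrow> norm (cQbar D (t + \<delta>)) \<le> K"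
    using bdd pos by (auto simp: bdd_meas_on_def)
  have shift: "bounded_measurable {s - \<delta>..T} (\<lambda>t. f (t + \<delta>))"
    if "bounded_measurable {s..T + \<delta>} f" for f :: "real \<Rightarrow> 'e::euclidean_space"
    using bounded_measurable_shift[OF that, of \<delta>] by simp
  have Qsum_bm: "bounded_measurable {s - \<delta>..T} (Qsum D \<delta>)"
    unfolding Qsum_def by (intro bounded_measurable_add bm shift)
  have Qsum_le: "norm (Qsum D \<delta> t) \<le> 2 * K" if "t \<in> {s..T}" for t
    using norm_triangle_ineq[of "cQ D t" "cQbar D (t + \<delta>)"] norm_le(6,7)[OF that] by (simp add: Qsum_def)
  obtain c where c: "c > 0" "\<And>t. t \<in> {s - \<delta>..T} \<Longrightarrow> norm (Qsum D \<delta> t) \<le> c"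
    using Qsum_bm by (auto simp: bounded_measurable_def bounded_pos)
  \<comment> \<open>The identity is unbounded on the cone, so the closed set is cut down to a ball
    containing all values of \<open>Qsum\<close>.\<close>
  have "bounded_measurable {s - \<delta>..T}
      (\<lambda>t. if Qsum D \<delta> t \<in> psd_mats \<inter> cball 0 c then Qsum D \<delta> t else 0)"
    using Qsum_bm c by (intro bounded_measurable_restrict_closed[where c = c and h = "\<lambda>x. x"])
      (auto simp: bounded_measurable_def intro!: closed_Int closed_psd continuous_intros)
  moreover have "(if Qsum D \<delta> t \<in> psd_mats \<inter> cball 0 c then Qsum D \<delta> t else 0) = regular_Q D \<delta> t"
    if "t \<in> {s - \<delta>..T}" for t
    using c(2)[OF that] by (simp add: regular_Q_def)
  ultimately have "bounded_measurable {s - \<delta>..T} (regular_Q D \<delta>)"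
    by (rule bounded_measurable_cong)
  then have rQ: "bounded_measurable {s..T} (regular_Q D \<delta>)"
    by (rule bounded_measurable_subset) (use pos in auto)
  have "bounded_measurable {s - \<delta>..T} (calN D \<delta>)"
    unfolding calN_def by (intro bounded_measurable_add bounded_measurable_scaleR bm shift)
  \<comment> \<open>The interval begins at s - \<delta> because the inverse is also evaluated at t -
    \<delta>.\<close>
  then have rN: "bounded_measurable {s - \<delta>..T} (regular_Ninv D \<alpha> \<delta>)"
    unfolding regular_Ninv_def
    by (intro bounded_measurable_restrict_closed[where c = "CARD('d) / (2 * \<alpha>)"] closed_coercive_mats
        continuous_on_matrix_inv continuous_on_id)
      (use pos in \<open>auto simp: bounded_measurable_def coercive_mats_def
        intro!: norm_matrix_inv_coercive pd_imp_invertible coercive_pd[of _ "2 * \<alpha>"]\<close>)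
  have rN1: "bounded_measurable {s..T} (regular_Ninv D \<alpha> \<delta>)"
    by (rule bounded_measurable_subset[OF rN]) (use pos in auto)
  have rN2: "bounded_measurable {s..T} (\<lambda>t. regular_Ninv D \<alpha> \<delta> (t - \<delta>))"
    using bounded_measurable_subset[OF bounded_measurable_shift[OF rN, of "- \<delta>"], of "{s..T}"] pos by auto
  have G_le: "norm (regular_G D \<alpha> \<delta> t) \<le> K\<^sup>2 * (CARD('d) / \<alpha>)" if t: "t \<in> {s..T}" for t
  proof -
    have "norm (cC D t ** regular_Ninv D \<alpha> \<delta> t ** transpose (cC D t)) \<le> K * (CARD('d) / (2 * \<alpha>)) * K"
      by (rule norm_matrix_mult3_le) (use norm_le(4)[OF t] norm_regular_Ninv_le[OF pos(1)] in auto)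
    moreover have "norm (cCbar D t ** regular_Ninv D \<alpha> \<delta> (t - \<delta>) ** transpose (cCbar D t))
        \<le> K * (CARD('d) / (2 * \<alpha>)) * K"
      by (rule norm_matrix_mult3_le) (use norm_le(5)[OF t] norm_regular_Ninv_le[OF pos(1)] in auto)
    ultimately have "norm (regular_G D \<alpha> \<delta> t) \<le> K * (CARD('d) / (2 * \<alpha>)) * K + K * (CARD('d) / (2 * \<alpha>)) * K"
      unfolding regular_G_def by (rule norm_triangle_le[OF add_mono])
    then show ?thesis by (simp add: power2_eq_square field_simps)
  qed
  have "sigma_equation s T \<delta> L (cA D) (cB D) (cBbar D) (regular_Q D \<delta>) (regular_G D \<alpha> \<delta>) M"
  proof
    show "bounded_measurable {s..T} (cBbar D)"
      by (rule bounded_measurable_subset[OF bm(3)]) (use pos in auto)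
    show "bounded_measurable {s..T} (regular_G D \<alpha> \<delta>)"
      unfolding regular_G_def
      by (intro bounded_measurable_add bounded_measurable_matrix_mult bounded_measurable_transpose bm rN1 rN2)
    show "norm (regular_Q D \<delta> t) \<le> L" if "t \<in> {s..T}" for t
      using Qsum_le[OF that] L by (simp add: regular_Q_def)
    show "regular_Q D \<delta> t \<in> psd_mats" for t by (simp add: regular_Q_def psd_zero)
    show "regular_G D \<alpha> \<delta> t \<in> psd_mats" for t
      unfolding regular_G_def by (intro psd_add psd_congruence regular_Ninv_psd pos)
    fix t assume t: "t \<in> {s..T}"
    show "norm (cA D t) \<le> L" "norm (cB D t) \<le> L" "norm (cBbar D t) \<le> L"
      using norm_le(1-3)[OF t] L(1) by linarith+
    show "norm (regular_G D \<alpha> \<delta> t) \<le> L" by (rule order_trans[OF G_le[OF t] L(3)])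
  qed (use sT pos L M bm rQ in auto)
  then show ?thesis by (simp add: L_def)
qed

lemma regular_coefficients_negligible:
  fixes D :: "('n::finite, 'd::finite) lq_data"
  assumes lq: "lq_setting T K \<alpha> \<delta> s D" and "\<delta> > 0"
  obtains Z where "negligible Z" "\<And>t. t \<in> {s..T} - Z \<Longrightarrow> regular_Q D \<delta> t = Qsum D \<delta> t"
    "\<And>t. t \<in> {s..T} - Z \<Longrightarrow> regular_G D \<alpha> \<delta> t = cC D t ** matrix_inv (calN D \<delta> t) ** transpose (cC D t)
      + cCbar D t ** matrix_inv (calN D \<delta> (t - \<delta>)) ** transpose (cCbar D t)"
proof -
  obtain Z1 where Z1: "negligible Z1" "\<And>t. t \<in> {s - \<delta>..T} - Z1 \<Longrightarrow> Qsum D \<delta> t \<in> psd_mats"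
    using lq by (auto simp: lq_setting_def elim!: AE_lebesgue_on_negligible)
  obtain Z2 where Z2: "negligible Z2" "\<And>t. t \<in> {s - \<delta>..T} - Z2 \<Longrightarrow>
      cN D t + cNbar D (t + \<delta>) - \<alpha> *\<^sub>R mat 1 \<in> psd_mats"
    using lq by (auto simp: lq_setting_def elim!: AE_lebesgue_on_negligible)
  have N: "regular_Ninv D \<alpha> \<delta> t = matrix_inv (calN D \<delta> t)" if "t \<in> {s - \<delta>..T} - Z2" for t
  proof -
    have "calN D \<delta> t - (2 * \<alpha>) *\<^sub>R mat 1 = 2 *\<^sub>R (cN D t + cNbar D (t + \<delta>) - \<alpha> *\<^sub>R mat 1)"
      by (simp add: calN_def algebra_simps)
    then show ?thesis
      using psd_scaleR[OF Z2(2)[OF that], of 2] by (simp add: regular_Ninv_def coercive_mats_def)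
  qed
  show ?thesis
  \<comment> \<open>The translate of Z2 collects the times t whose delayed argument t - \<delta> is
    exceptional.\<close>
  proof (rule that[of "Z1 \<union> Z2 \<union> (+) \<delta> ` Z2"])
    show "negligible (Z1 \<union> Z2 \<union> (+) \<delta> ` Z2)"
      by (intro negligible_Un Z1 Z2 negligible_translation)
    fix t assume t: "t \<in> {s..T} - (Z1 \<union> Z2 \<union> (+) \<delta> ` Z2)"
    then have "t - \<delta> \<notin> Z2" by (metis DiffD2 UnI2 add.commute diff_add_cancel image_eqI)
    with t N[of t] N[of "t - \<delta>"] Z1(2)[of t] \<open>\<delta> > 0\<close>
    show "regular_Q D \<delta> t = Qsum D \<delta> t"
      "regular_G D \<alpha> \<delta> t = cC D t ** matrix_inv (calN D \<delta> t) ** transpose (cC D t)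
        + cCbar D t ** matrix_inv (calN D \<delta> (t - \<delta>)) ** transpose (cCbar D t)"
      by (simp_all add: regular_Q_def regular_G_def)
  qed
qed

text \<open>Solutions in integrated form do not see null sets, so modified and original coefficients
  define the same equation; fixing P before s makes \<open>delayed\<close> agree with P (t -
  \<delta>).\<close>

lemma riccati_solution_iff_ric_solution:
  fixes D :: "('n::finite, 'd::finite) lq_data"
  assumes lq: "lq_setting T K \<alpha> \<delta> s D" and "\<delta> > 0"
    and sigma: "sigma_equation s T \<delta> L (cA D) (cB D) (cBbar D) (regular_Q D \<delta>) (regular_G D \<alpha> \<delta>) M"
    and past: "\<And>t. t \<in> {s - \<delta>..<s} \<Longrightarrow> P t = mat 1"
  shows "riccati_solution T \<delta> s D M P \<longleftrightarrow>
    sigma_equation.ric_solution s T \<delta> (cA D) (cB D) (cBbar D) (regular_Q D \<delta>) (regular_G D \<alpha> \<delta>) M P"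
proof -
  interpret sigma_equation s T \<delta> L "cA D" "cB D" "cBbar D" "regular_Q D \<delta>" "regular_G D \<alpha> \<delta>" M
    by (rule sigma)
  obtain Z where Z: "negligible Z" "\<And>t. t \<in> {s..T} - Z \<Longrightarrow> regular_Q D \<delta> t = Qsum D \<delta> t"
    "\<And>t. t \<in> {s..T} - Z \<Longrightarrow> regular_G D \<alpha> \<delta> t = cC D t ** matrix_inv (calN D \<delta> t) ** transpose (cC D t)
      + cCbar D t ** matrix_inv (calN D \<delta> (t - \<delta>)) ** transpose (cCbar D t)"
    using regular_coefficients_negligible[OF lq \<open>\<delta> > 0\<close>] by blast
  have delay: "delayed s \<delta> (mat 1) P t = P (t - \<delta>)" if "t \<in> {s..T}" for t
    using past[of "t - \<delta>"] that by (auto simp: delayed_def)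
  have "P t ** cA D t + transpose (cA D t) ** P t - 2 *\<^sub>R Qsum D \<delta> t
            + P t ** cB D t ** matrix_inv (P t) ** transpose (cB D t) ** P t
            + P t ** cC D t ** matrix_inv (calN D \<delta> t) ** transpose (cC D t) ** P t
            + P t ** cBbar D t ** matrix_inv (P (t - \<delta>)) ** transpose (cBbar D t) ** P t
            + P t ** cCbar D t ** matrix_inv (calN D \<delta> (t - \<delta>)) ** transpose (cCbar D t) ** P t
        = ric t (P t) (matrix_inv (delayed s \<delta> (mat 1) P t))" if "t \<in> {s..T} - Z" for t
    using that by (simp add: ric_def Z(2,3) delay matrix_mult_simps matrix_mul_assoc)
  from ode_solution_on_negligible_cong[OF Z(1) this]
  show ?thesis
    unfolding riccati_solution_def ric_solution_def using past by simp
qed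

theorem proposition4p3:
  fixes T K \<alpha> :: real
  assumes "T > 0" and "\<alpha> > 0"
  shows "\<exists>\<delta>0>0. \<forall>\<delta> s. \<forall>(D :: ('n::finite, 'd::finite) lq_data) (M :: real^'n^'n).
           0 < \<delta> \<longrightarrow> \<delta> \<le> \<delta>0 \<longrightarrow> s \<in> {0..T} \<longrightarrow>
           lq_setting T K \<alpha> \<delta> s D \<longrightarrow>
           M \<in> pd_mats \<longrightarrow> norm M \<le> K \<longrightarrow>
           cond_A4 T \<delta> s D M \<longrightarrow> cond_A5 T \<delta> s D M \<longrightarrow>
           (\<forall>t\<in>{s..T}. cB D t = mat 1) \<longrightarrow>
           (\<exists>P. riccati_solution T \<delta> s D M P \<and> (\<forall>t\<in>{s..T}. P t \<in> pd_mats) \<and>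
                (\<forall>P'. riccati_solution T \<delta> s D M P' \<longrightarrow> (\<forall>t\<in>{s..T}. P' t = P t)))"
proof -
  define N where "N = real CARD('n)"
  define L where "L = 2 * \<bar>K\<bar> + K\<^sup>2 * (CARD('d) / \<alpha>)"
  \<comment> \<open>The added 1 keeps \<theta>1 positive even when L = 0.\<close>
  define \<theta>1 where "\<theta>1 = 2 * (N^3 * (2 * L + L\<^sup>2) + 2 * (N^3 * L\<^sup>2)) + 1"
  \<comment> \<open>The full horizon T replaces T - s, so that R, and with it the admissible delay,
    is the same for every s.\<close>
  define R where "R = N\<^sup>2 * (2 * (N * L + T * (N * L + N^3 * L\<^sup>2 * N)) * exp (\<theta>1 * T))"
  \<comment> \<open>Adding \<theta>1 makes \<theta> the larger weight, so the single condition
    \<delta> \<le> ln 2 / \<theta> keeps both exponential factors below 2.\<close>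
  define \<theta> where "\<theta> = 2 * ((2 * L + L\<^sup>2 + 4 * R * L) + 2 * L\<^sup>2) + \<theta>1"
  have nonneg: "N \<ge> 0" "L \<ge> 0" using assms by (auto simp: N_def L_def)
  have \<theta>1: "\<theta>1 > 0" using nonneg by (auto simp: \<theta>1_def intro!: add_nonneg_pos)
  have R: "R \<ge> 0" using nonneg assms by (auto simp: R_def)
  have \<theta>: "\<theta> \<ge> \<theta>1" using nonneg R by (simp add: \<theta>_def)
  show ?thesis
  proof (intro exI[of _ "ln 2 / \<theta>"] conjI allI impI)
    show "ln 2 / \<theta> > 0" using \<theta> \<theta>1 by simp
  next
    fix \<delta> s and D :: "('n, 'd) lq_data" and M :: "real^'n^'n"
    assume \<delta>: "0 < \<delta>" "\<delta> \<le> ln 2 / \<theta>" and s: "s \<in> {0..T}" and lq: "lq_setting T K \<alpha> \<delta> s D"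
      and M: "M \<in> pd_mats" "norm M \<le> K"
    have sT: "s \<le> T" using s by simp
    have sigma: "sigma_equation s T \<delta> L (cA D) (cB D) (cBbar D) (regular_Q D \<delta>) (regular_G D \<alpha> \<delta>) M"
      unfolding L_def by (rule lq_setting_sigma_equation[OF lq \<open>\<alpha> > 0\<close> \<delta>(1) sT M])
    then interpret sigma_equation s T \<delta> L "cA D" "cB D" "cBbar D" "regular_Q D \<delta>" "regular_G D \<alpha> \<delta>" M .
    note iff = riccati_solution_iff_ric_solution[OF lq \<delta>(1) sigma]
    have "\<theta> * \<delta> \<le> ln 2" using \<delta> \<theta> \<theta>1 by (simp add: pos_le_divide_eq mult.commute)
    moreover have "\<theta>1 * \<delta> \<le> \<theta> * \<delta>" using \<delta> \<theta> by (intro mult_right_mono) auto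
    moreover have "exp x \<le> 2" if "x \<le> ln 2" for x :: real
      using that by (metis exp_le_cancel_iff exp_ln zero_less_numeral)
    ultimately have exps: "exp (\<theta> * \<delta>) \<le> 2" "exp (\<theta>1 * \<delta>) \<le> 2" by auto
    have "N\<^sup>2 * (2 * (N * L + (T - s) * (N * L + N^3 * L\<^sup>2 * N)) * exp (\<theta>1 * (T - s))) \<le> R"
      unfolding R_def using s \<theta>1 nonneg
      by (intro mult_left_mono mult_mono add_left_mono mult_right_mono) auto
    then obtain X where X: "sigma_solution X"
      and X_unique: "\<And>Y t. sigma_solution Y \<Longrightarrow> t \<in> {s..T} \<Longrightarrow> Y t = X t"
      using sigma_solution_exists_unique[of \<theta>1 R \<theta>] \<theta> \<theta>1 R exps
      unfolding N_def \<theta>1_def \<theta>_def by auto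
    \<comment> \<open>Before s the value is the prescribed identity; the inverse of X is used from s
      on, with no matching at s.\<close>
    define P where "P t = (if t < s then mat 1 else matrix_inv (X t))" for t
    have P_eq: "P t = matrix_inv (X t)" if "t \<in> {s..T}" for t using that by (simp add: P_def)
    show "\<exists>P. riccati_solution T \<delta> s D M P \<and> (\<forall>t\<in>{s..T}. P t \<in> pd_mats) \<and>
        (\<forall>P'. riccati_solution T \<delta> s D M P' \<longrightarrow> (\<forall>t\<in>{s..T}. P' t = P t))"
    proof (intro exI[of _ P] conjI allI impI ballI)
      show "P t \<in> pd_mats" if "t \<in> {s..T}" for t
        using sigma_solution_imp_ric_solution(2)[OF X that] by (simp add: P_eq[OF that])
      have past: "past P t = past (\<lambda>t. matrix_inv (X t)) t" for t
        by (simp add: delayed_def P_def)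
      have ric: "ric_solution (\<lambda>t. matrix_inv (X t))"
        by (rule sigma_solution_imp_ric_solution(1)[OF X])
      have "ode_solution_on s T P (\<lambda>t. ric t (P t) (matrix_inv (past P t)))"
        unfolding ode_solution_on_def
      proof (intro conjI ballI)
        show "continuous_on {s..T} P"
          by (rule continuous_on_eq[of _ "\<lambda>t. matrix_inv (X t)"])
            (use ric in \<open>auto simp: ric_solution_def ode_solution_on_def P_eq\<close>)
        fix t assume t: "t \<in> {s..T}"
        have "((\<lambda>r. ric r (matrix_inv (X r)) (matrix_inv (past P r))) has_integral (P t - P s)) {s..t}"
          using ric t P_eq[of t] P_eq[of s] unfolding ric_solution_def ode_solution_on_def past by auto
        then show "((\<lambda>r. ric r (P r) (matrix_inv (past P r))) has_integral (P t - P s)) {s..t}"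
          by (rule has_integral_eq[rotated]) (use t P_eq in auto)
      qed
      then have "ric_solution P"
        using ric sT by (simp add: ric_solution_def P_eq)
      then show "riccati_solution T \<delta> s D M P" by (subst iff) (auto simp: P_def)
    next
      fix P' t assume P': "riccati_solution T \<delta> s D M P'" and t: "t \<in> {s..T}"
      then have ric: "ric_solution P'"
        using iff[of P'] by (auto simp: riccati_solution_def)
      \<comment> \<open>Uniqueness is settled among the inverses and then transferred back by
        inverting once more.\<close>
      then have "matrix_inv (P' t) = X t"
        using X_unique[OF ric_solution_imp_sigma_solution t] by blast
      moreover have "invertible (P' t)" using ric t by (auto simp: ric_solution_def)
      ultimately show "P' t = P t" using P_eq[OF t] matrix_inv_matrix_inv by metis
    qed
  qed
qed

end
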